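(* Let $w\in L^1(\mathbb{R}^d)\cap L^\infty(\mathbb{R}^d)$, $w\neq0$, be a non-negative function, and let $k(x,y)=\widehat{w}(x-y)$ for $x,y\in\mathbb{R}^d$. Let $f:\mathbb{R}^d\to\mathbb{R}^d$ be an affine map $f(x)=Ax+b$ with $A\in{\rm M}_d(\mathbb{R})$ and $b\in\mathbb{R}^d$. Then $A\in\mathcal{G}(w)$ if and only if $\mathcal{D}(C_f)=H_k$ (and $C_f$ is bounded on $H_k$).
   Context: Fourier transform: $\widehat{h}(\xi)=\int_{\mathbb{R}^d}h(x)e^{-2\pi i x\cdot\xi}\,dx$. $H_k\subset\mathbb{C}^{\mathbb{R}^d}$ is the reproducing kernel Hilbert space of the positive definite kernel $k$: $k_x:=k(x,\cdot)\in H_k$ and $\langle h,k_x\rangle_{H_k}=h(x)$. The composition operator $C_f:H_k\to H_k$ is $C_fh=h\circ f$ with domain $\mathcal{D}(C_f)=\{h\in H_k:h\circ f\in H_k\}$. $\mathcal{G}(w)$ is the set of $A\in{\rm GL}_d(\mathbb{R})$ such that for some $\lambda>0$, $w(A^\top\xi)\ge\lambda w(\xi)$ for almost every $\xi\in\mathbb{R}^d$. *)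

theory Defs
  imports "HOL-Analysis.Analysis"
begin

definition fourier :: "(real ^ 'n \<Rightarrow> complex) \<Rightarrow> real ^ 'n \<Rightarrow> complex" where
  "fourier h \<xi> = (LINT x|lebesgue. h x * exp (- 2 * of_real pi * \<i> * of_real (x \<bullet> \<xi>)))"

definition ip_norm :: "(('a \<Rightarrow> complex) \<Rightarrow> ('a \<Rightarrow> complex) \<Rightarrow> complex) \<Rightarrow> ('a \<Rightarrow> complex) \<Rightarrow> real" where
  "ip_norm ip h = sqrt (Re (ip h h))"

text \<open>A complex Hilbert space whose vectors are functions on \<open>'a\<close>, with the pointwise vector space
  structure. The inner product is linear in its first argument, as the reproducing property below
  forces. Its values outside \<open>H\<close> are irrelevant.\<close>

locale hilbert_function_space =
  fixes H :: "('a \<Rightarrow> complex) set"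
    and ip :: "('a \<Rightarrow> complex) \<Rightarrow> ('a \<Rightarrow> complex) \<Rightarrow> complex"
  assumes zero_mem: "(\<lambda>_. 0) \<in> H"
    and add_mem: "\<lbrakk>g \<in> H; h \<in> H\<rbrakk> \<Longrightarrow> (\<lambda>x. g x + h x) \<in> H"
    and scale_mem: "h \<in> H \<Longrightarrow> (\<lambda>x. c * h x) \<in> H"
    and ip_add_left: "\<lbrakk>g \<in> H; h \<in> H; u \<in> H\<rbrakk> \<Longrightarrow> ip (\<lambda>x. g x + h x) u = ip g u + ip h u"
    and ip_scale_left: "\<lbrakk>h \<in> H; u \<in> H\<rbrakk> \<Longrightarrow> ip (\<lambda>x. c * h x) u = c * ip h u"
    and ip_commute: "\<lbrakk>g \<in> H; h \<in> H\<rbrakk> \<Longrightarrow> ip g h = cnj (ip h g)"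
    and ip_nonneg: "h \<in> H \<Longrightarrow> 0 \<le> Re (ip h h)"
    and ip_definite: "\<lbrakk>h \<in> H; ip h h = 0\<rbrakk> \<Longrightarrow> h = (\<lambda>_. 0)"
    and complete:
      "\<lbrakk>\<And>n. s n \<in> H;
        \<And>e. e > 0 \<Longrightarrow> \<exists>N. \<forall>m\<ge>N. \<forall>n\<ge>N.
          ip_norm ip (\<lambda>x. s m x - s n x) < e\<rbrakk>
       \<Longrightarrow> \<exists>h\<in>H. (\<lambda>n::nat. ip_norm ip (\<lambda>x. s n x - h x)) \<longlonglongrightarrow> 0"

text \<open>\<open>(H, ip)\<close> is the reproducing kernel Hilbert space of \<open>k\<close>. By the Moore--Aronszajn theorem these
  conditions determine \<open>H\<close>, and \<open>ip\<close> on \<open>H\<close>, uniquely, and such a space exists if and only if \<open>k\<close> is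
  positive definite.\<close>

locale rkhs = hilbert_function_space H ip
  for k :: "'a \<Rightarrow> 'a \<Rightarrow> complex"
    and H :: "('a \<Rightarrow> complex) set"
    and ip :: "('a \<Rightarrow> complex) \<Rightarrow> ('a \<Rightarrow> complex) \<Rightarrow> complex" +
  assumes kernel_mem: "k x \<in> H"
    and reproducing: "h \<in> H \<Longrightarrow> ip h (k x) = h x"

definition comp_op :: "('a \<Rightarrow> 'a) \<Rightarrow> ('a \<Rightarrow> complex) \<Rightarrow> ('a \<Rightarrow> complex)" where
  "comp_op f h = h \<circ> f"

definition comp_dom :: "('a \<Rightarrow> complex) set \<Rightarrow> ('a \<Rightarrow> 'a) \<Rightarrow> ('a \<Rightarrow> complex) set" where
  "comp_dom H f = {h \<in> H. comp_op f h \<in> H}"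

definition bounded_operator_on ::
    "('a \<Rightarrow> complex) set \<Rightarrow> (('a \<Rightarrow> complex) \<Rightarrow> ('a \<Rightarrow> complex) \<Rightarrow> complex)
      \<Rightarrow> (('a \<Rightarrow> complex) \<Rightarrow> ('a \<Rightarrow> complex)) \<Rightarrow> bool" where
  "bounded_operator_on H ip T \<longleftrightarrow>
     (\<forall>h\<in>H. T h \<in> H) \<and> (\<exists>C. \<forall>h\<in>H. ip_norm ip (T h) \<le> C * ip_norm ip h)"

definition weight_matrices :: "(real ^ 'n \<Rightarrow> real) \<Rightarrow> (real ^ 'n ^ 'n) set" where
  "weight_matrices w =
     {A. invertible A \<and> (\<exists>l>0. AE \<xi> in lebesgue. w (transpose A *v \<xi>) \<ge> l * w \<xi>)}"

end

theory Submission
  imports Defs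
begin

text \<open>Write \<open>e\<^sub>x(\<xi>) = exp (-2\<pi>i x\<cdot>\<xi>)\<close>. Since \<open>k x y\<close> is the integral of \<open>w e\<^sub>x\<close> times the conjugate of
\<open>e\<^sub>y\<close>, the squared norm of \<open>\<Sum> a\<^sub>i k\<^bsub>x\<^sub>i\<^esub>\<close> in \<open>H\<close> is the integral of \<open>w |\<Sum> a\<^sub>i e\<^bsub>x\<^sub>i\<^esub>|\<^sup>2\<close>
(\<open>norm_sq_lincomb\<close>). The adjoint of \<open>C\<^sub>f\<close> sends \<open>k\<^sub>x\<close> to \<open>k\<^bsub>f x\<^esub>\<close>, and
\<open>e\<^bsub>Ax + b\<^esub>(\<xi>) = e\<^sub>b(\<xi>) e\<^sub>x(A\<^sup>T\<xi>)\<close> with a unimodular first factor. So boundedness of \<open>C\<^sub>f\<close> amounts to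
the inequality \<open>\<integral> w(\<xi>) |p(A\<^sup>T\<xi>)|\<^sup>2 d\<xi> \<le> C \<integral> w(\<xi>) |p(\<xi>)|\<^sup>2 d\<xi>\<close> for all trigonometric polynomials \<open>p\<close>.
The translation part \<open>b\<close> has disappeared.

That this inequality is equivalent to \<open>D(C\<^sub>f) = H\<close>, and makes \<open>C\<^sub>f\<close> bounded, is Hilbert space theory.
If it holds, then for \<open>h\<close> in \<open>H\<close> the functional \<open>\<Sum> a\<^sub>i k\<^bsub>x\<^sub>i\<^esub> \<mapsto> \<Sum> a\<^sub>i cnj (h (f x\<^sub>i))\<close> is bounded, and the
vector representing it is \<open>h \<circ> f\<close> (\<open>mem_if_bounded_on_kernels\<close>). Conversely, if \<open>h \<circ> f\<close> lies in \<open>H\<close>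
for every \<open>h\<close>, the images under the adjoint of the kernel sums of norm at most 1 are weakly bounded,
hence bounded by the uniform boundedness principle (\<open>bounded_if_comp_dom_full\<close>).

It remains to compare the inequality with the condition on \<open>w\<close>. If \<open>w(A\<^sup>T\<xi>) \<ge> l w(\<xi>)\<close> with \<open>A\<close> invertible,
the inequality follows from the linear change of variables (\<open>quadratic_le_if_weight_le\<close>). Conversely,
let \<open>\<mu>\<close> be the measure with density \<open>w\<close> and \<open>\<nu>\<close> its image under \<open>A\<^sup>T\<close>; the inequality compares
\<open>\<integral> |p|\<^sup>2 d\<nu>\<close> with \<open>\<integral> |p|\<^sup>2 d\<mu>\<close>. Trigonometric polynomials are dense in \<open>L\<^sup>2(\<mu> + \<nu>)\<close>, so indicator functions
may be inserted for \<open>p\<close>, and \<open>\<nu>\<close> is at most a constant times \<open>\<mu>\<close> on Borel sets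
(\<open>measure_le_if_trig_le\<close>). If \<open>A\<close> were singular, \<open>\<nu>\<close> would be a nonzero measure living on a proper
subspace, which is null for \<open>\<mu>\<close>; so \<open>A\<close> is invertible, and comparing densities gives the condition on \<open>w\<close>
(\<open>weight_le_if_quadratic_le\<close>).\<close>

section \<open>Hilbert spaces of functions\<close>

context hilbert_function_space begin

lemma diff_mem: "\<lbrakk>g \<in> H; h \<in> H\<rbrakk> \<Longrightarrow> (\<lambda>x. g x - h x) \<in> H"
  using add_mem[of g "\<lambda>x. (-1) * h x"] scale_mem[of h "-1"] by simp

lemma ip_diff_left: "\<lbrakk>g \<in> H; h \<in> H; u \<in> H\<rbrakk> \<Longrightarrow> ip (\<lambda>x. g x - h x) u = ip g u - ip h u"
  using ip_add_left[of g "\<lambda>x. (-1) * h x" u] scale_mem[of h "-1"] ip_scale_left[of h u "-1"] by simp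

lemma ip_zero_left: "u \<in> H \<Longrightarrow> ip (\<lambda>_. 0) u = 0"
  using ip_scale_left[of "\<lambda>_. 0" u 0] zero_mem by simp

lemma ip_add_right: "\<lbrakk>g \<in> H; h \<in> H; u \<in> H\<rbrakk> \<Longrightarrow> ip u (\<lambda>x. g x + h x) = ip u g + ip u h"
  using ip_add_left[of g h u] ip_commute[of u "\<lambda>x. g x + h x"] ip_commute[of u g] ip_commute[of u h]
    add_mem[of g h] by simp

lemma ip_scale_right: "\<lbrakk>h \<in> H; u \<in> H\<rbrakk> \<Longrightarrow> ip u (\<lambda>x. c * h x) = cnj c * ip u h"
  using ip_scale_left[of h u c] ip_commute[of u "\<lambda>x. c * h x"] ip_commute[of u h]
    scale_mem[of h c] by simp

lemma ip_zero_right: "u \<in> H \<Longrightarrow> ip u (\<lambda>_. 0) = 0"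
  using ip_scale_right[of "\<lambda>_. 0" u 0] zero_mem by simp

lemma ip_self: "h \<in> H \<Longrightarrow> ip h h = complex_of_real ((ip_norm ip h)\<^sup>2)"
  using ip_commute[of h h] ip_nonneg[of h]
  by (auto simp: ip_norm_def complex_eq_iff)

lemma norm_nonneg: "h \<in> H \<Longrightarrow> 0 \<le> ip_norm ip h"
  using ip_nonneg[of h] by (simp add: ip_norm_def)

lemma norm_scale: "h \<in> H \<Longrightarrow> ip_norm ip (\<lambda>x. c * h x) = cmod c * ip_norm ip h"
proof -
  assume h: "h \<in> H"
  have "ip (\<lambda>x. c * h x) (\<lambda>x. c * h x) = (c * cnj c) * ip h h"
    using h by (simp add: ip_scale_left ip_scale_right scale_mem)
  also have "\<dots> = complex_of_real ((cmod c)\<^sup>2 * (ip_norm ip h)\<^sup>2)"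
    by (simp add: ip_self[OF h] complex_norm_square del: of_real_power)
  finally have "ip_norm ip (\<lambda>x. c * h x) = sqrt ((cmod c)\<^sup>2 * (ip_norm ip h)\<^sup>2)"
    by (simp add: ip_norm_def del: of_real_mult of_real_power)
  then show ?thesis
    using norm_nonneg[OF h] by (simp add: real_sqrt_mult)
qed

lemma norm_add_sq:
  assumes "g \<in> H" "h \<in> H"
  shows "(ip_norm ip (\<lambda>x. g x + h x))\<^sup>2 = (ip_norm ip g)\<^sup>2 + 2 * Re (ip g h) + (ip_norm ip h)\<^sup>2"
proof -
  have "complex_of_real ((ip_norm ip (\<lambda>x. g x + h x))\<^sup>2) = ip g g + ip g h + ip h g + ip h h"
    using assms by (simp add: ip_self[symmetric] add_mem ip_add_left ip_add_right del: of_real_power)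
  moreover have "Re (ip h g) = Re (ip g h)"
    using ip_commute[OF assms(2,1)] by simp
  ultimately show ?thesis
    using ip_self[OF assms(1)] ip_self[OF assms(2)] by (simp add: complex_eq_iff)
qed

lemma norm_diff_sq:
  assumes "g \<in> H" "h \<in> H"
  shows "(ip_norm ip (\<lambda>x. g x - h x))\<^sup>2 = (ip_norm ip g)\<^sup>2 - 2 * Re (ip g h) + (ip_norm ip h)\<^sup>2"
  using norm_add_sq[of g "\<lambda>x. (-1) * h x"] assms scale_mem[of h "-1"] ip_scale_right[of h g "-1"]
    norm_scale[of h "-1"] by simp

lemma cauchy_schwarz:
  assumes g: "g \<in> H" and h: "h \<in> H"
  shows "cmod (ip g h) \<le> ip_norm ip g * ip_norm ip h"
proof (cases "ip_norm ip h = 0")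
  case True
  then have "h = (\<lambda>_. 0)" using ip_definite[OF h] ip_self[OF h] by simp
  then show ?thesis using ip_zero_right[OF g] norm_nonneg[OF g] True by simp
next
  case False
  define n where "n = (ip_norm ip h)\<^sup>2"
  have n: "n > 0" using False by (simp add: n_def)
  define c where "c = ip g h / of_real n"
  have ch: "(\<lambda>x. c * h x) \<in> H" using scale_mem[OF h] .
  have "0 \<le> (ip_norm ip (\<lambda>x. g x - c * h x))\<^sup>2" by simp
  also have "\<dots> = (ip_norm ip g)\<^sup>2 - 2 * Re (cnj c * ip g h) + (cmod c)\<^sup>2 * n"
    using norm_diff_sq[OF g ch] norm_scale[OF h, of c] ip_scale_right[OF h g, of c]
    by (simp add: n_def power_mult_distrib)
  also have "Re (cnj c * ip g h) = (cmod (ip g h))\<^sup>2 / n"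
    by (simp add: c_def cmod_power2 add_divide_distrib) (simp add: power2_eq_square)
  also have "(cmod c)\<^sup>2 * n = (cmod (ip g h))\<^sup>2 / n"
    using n by (simp add: c_def norm_divide power_divide power2_eq_square)
  finally have "(cmod (ip g h))\<^sup>2 \<le> (ip_norm ip g)\<^sup>2 * n"
    using n by (simp add: field_simps)
  then have "(cmod (ip g h))\<^sup>2 \<le> (ip_norm ip g * ip_norm ip h)\<^sup>2"
    by (simp add: n_def power_mult_distrib)
  then show ?thesis
    by (rule power2_le_imp_le) (simp add: norm_nonneg[OF g] norm_nonneg[OF h])
qed

lemma norm_triangle:
  assumes g: "g \<in> H" and h: "h \<in> H"
  shows "ip_norm ip (\<lambda>x. g x + h x) \<le> ip_norm ip g + ip_norm ip h"
proof (rule power2_le_imp_le)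
  have "Re (ip g h) \<le> ip_norm ip g * ip_norm ip h"
    using cauchy_schwarz[OF assms] complex_Re_le_cmod order_trans by blast
  then show "(ip_norm ip (\<lambda>x. g x + h x))\<^sup>2 \<le> (ip_norm ip g + ip_norm ip h)\<^sup>2"
    unfolding norm_add_sq[OF assms] by (simp add: power2_sum)
qed (use norm_nonneg[OF g] norm_nonneg[OF h] in simp)

lemma norm_diff_triangle:
  assumes "g \<in> H" "h \<in> H" "u \<in> H"
  shows "ip_norm ip (\<lambda>x. g x - u x) \<le> ip_norm ip (\<lambda>x. g x - h x) + ip_norm ip (\<lambda>x. h x - u x)"
  using norm_triangle[OF diff_mem[OF assms(1,2)] diff_mem[OF assms(2,3)]] by simp

lemma norm_diff_commute:
  assumes "g \<in> H" "h \<in> H"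
  shows "ip_norm ip (\<lambda>x. g x - h x) = ip_norm ip (\<lambda>x. h x - g x)"
  using norm_scale[OF diff_mem[OF assms], of "-1"] by (simp add: algebra_simps)

lemma ip_tendsto:
  assumes s: "\<And>n::nat. s n \<in> H" and h: "h \<in> H" and u: "u \<in> H"
    and lim: "(\<lambda>n. ip_norm ip (\<lambda>x. s n x - h x)) \<longlonglongrightarrow> 0"
  shows "(\<lambda>n. ip (s n) u) \<longlonglongrightarrow> ip h u"
proof -
  have "(\<lambda>n. ip_norm ip (\<lambda>x. s n x - h x) * ip_norm ip u) \<longlonglongrightarrow> 0"
    using tendsto_mult_left_zero[OF lim] .
  then have "(\<lambda>n. ip (s n) u - ip h u) \<longlonglongrightarrow> 0"
    by (rule Lim_null_comparison[rotated])
      (use s h u cauchy_schwarz[OF diff_mem[OF s h] u] in \<open>simp add: ip_diff_left\<close>)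
  then show ?thesis by (simp add: LIM_zero_iff)
qed

lemma norm_tendsto:
  assumes s: "\<And>n::nat. s n \<in> H" and h: "h \<in> H"
    and lim: "(\<lambda>n. ip_norm ip (\<lambda>x. s n x - h x)) \<longlonglongrightarrow> 0"
  shows "(\<lambda>n. ip_norm ip (s n)) \<longlonglongrightarrow> ip_norm ip h"
proof -
  have "\<bar>ip_norm ip (s n) - ip_norm ip h\<bar> \<le> ip_norm ip (\<lambda>x. s n x - h x)" for n
    using norm_triangle[OF diff_mem[OF s[of n] h] h] norm_triangle[OF diff_mem[OF h s[of n]] s[of n]]
      norm_diff_commute[OF h s[of n]] by simp
  then have "(\<lambda>n. ip_norm ip (s n) - ip_norm ip h) \<longlonglongrightarrow> 0"
    by (intro Lim_null_comparison[OF _ lim]) simp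
  then show ?thesis by (simp add: LIM_zero_iff)
qed

text \<open>The Riesz representation theorem for a bounded functional that is given on an arbitrary subspace, as
its graph \<open>R\<close>. A graph is used because the functionals of interest are prescribed on kernel sums, and a
function may be a kernel sum in many ways; that its value is the same each time then follows from the bound.
The functional \<open>\<parallel>g\<parallel>\<^sup>2 - 2 Re l\<close> is bounded below by \<open>-C\<^sup>2\<close>, minimising sequences are Cauchy
by the parallelogram law, and their limit \<open>u\<close>, which need not belong to the subspace, represents \<open>l\<close>
because the first variation vanishes.\<close>

lemma riesz_relation:
  fixes R :: "(('a \<Rightarrow> complex) \<times> complex) set"
  assumes ne: "R \<noteq> {}"
    and C: "C \<ge> 0"
    and sub: "\<And>g l. (g, l) \<in> R \<Longrightarrow> g \<in> H"
    and add: "\<And>g l g' l'. \<lbrakk>(g, l) \<in> R; (g', l') \<in> R\<rbrakk> \<Longrightarrow> (\<lambda>x. g x + g' x, l + l') \<in> R"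
    and scale: "\<And>g l c. (g, l) \<in> R \<Longrightarrow> (\<lambda>x. c * g x, c * l) \<in> R"
    and bound: "\<And>g l. (g, l) \<in> R \<Longrightarrow> cmod l \<le> C * ip_norm ip g"
  shows "\<exists>u\<in>H. (\<forall>g l. (g, l) \<in> R \<longrightarrow> ip g u = l) \<and> ip_norm ip u \<le> C"
proof -
  define Q where "Q r = (ip_norm ip (fst r))\<^sup>2 - 2 * Re (snd r)" for r :: "('a \<Rightarrow> complex) \<times> complex"
  define m where "m = Inf (Q ` R)"
  have "Q r \<ge> - C\<^sup>2" if "r \<in> R" for r
  proof -
    have "Re (snd r) \<le> C * ip_norm ip (fst r)"
      using bound[of "fst r" "snd r"] that complex_Re_le_cmod[of "snd r"] by simp
    moreover have "0 \<le> (ip_norm ip (fst r) - C)\<^sup>2" by simp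
    ultimately show ?thesis by (simp add: Q_def power2_diff mult.commute)
  qed
  then have bdd: "bdd_below (Q ` R)" by (intro bdd_belowI[of _ "- C\<^sup>2"]) auto
  have m_le: "m \<le> Q r" if "r \<in> R" for r
    unfolding m_def using bdd that by (simp add: cInf_lower)
  have "\<exists>r\<in>R. Q r < m + inverse (real (Suc n))" for n
  proof -
    have "Inf (Q ` R) < m + inverse (real (Suc n))"
      by (simp add: m_def)
    then show ?thesis
      using cInf_less_iff[of "Q ` R"] ne bdd by auto
  qed
  then obtain r where r: "\<And>n. r n \<in> R" "\<And>n. Q (r n) < m + inverse (real (Suc n))" by metis
  define s where "s n = fst (r n)" for n
  define l where "l n = snd (r n)" for n
  have sl: "(s n, l n) \<in> R" for n using r(1) by (simp add: s_def l_def)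
  have sH: "s n \<in> H" for n using sub[OF sl] .
  \<comment> \<open>The midpoint of two near-minimisers is in \<open>R\<close> too, so the parallelogram law forces them together.\<close>
  have close: "(ip_norm ip (\<lambda>x. s i x - s j x))\<^sup>2
      < 2 * (inverse (real (Suc i)) + inverse (real (Suc j)))" for i j
  proof -
    have mid: "(\<lambda>x. (1/2) * (s i x + s j x), (1/2) * (l i + l j)) \<in> R"
      using scale[OF add[OF sl sl]] .
    have "(ip_norm ip (\<lambda>x. (1/2) * (s i x + s j x)))\<^sup>2 = (ip_norm ip (\<lambda>x. s i x + s j x))\<^sup>2 / 4"
      by (subst norm_scale) (simp_all add: add_mem sH power2_eq_square norm_divide)
    then have "Q (\<lambda>x. (1/2) * (s i x + s j x), (1/2) * (l i + l j))
        = (ip_norm ip (\<lambda>x. s i x + s j x))\<^sup>2 / 4 - Re (l i) - Re (l j)"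
      unfolding Q_def fst_conv snd_conv by (simp only:) (simp add: field_simps)
    then have "m \<le> (ip_norm ip (\<lambda>x. s i x + s j x))\<^sup>2 / 4 - Re (l i) - Re (l j)"
      using m_le[OF mid] by simp
    moreover have "(ip_norm ip (\<lambda>x. s i x - s j x))\<^sup>2 + (ip_norm ip (\<lambda>x. s i x + s j x))\<^sup>2
        = 2 * (ip_norm ip (s i))\<^sup>2 + 2 * (ip_norm ip (s j))\<^sup>2"
      by (simp add: norm_add_sq norm_diff_sq sH)
    ultimately show ?thesis
      using r(2)[of i] r(2)[of j] by (simp add: Q_def s_def l_def)
  qed
  have "\<exists>u\<in>H. (\<lambda>n::nat. ip_norm ip (\<lambda>x. s n x - u x)) \<longlonglongrightarrow> 0"
  proof (rule complete)
    fix e :: real assume e: "e > 0"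
    obtain N where N: "inverse (real (Suc N)) < e\<^sup>2 / 4"
      using reals_Archimedean[of "e\<^sup>2 / 4"] e by auto
    have "ip_norm ip (\<lambda>x. s i x - s j x) < e" if "i \<ge> N" "j \<ge> N" for i j
    proof (rule power2_less_imp_less)
      have "inverse (real (Suc i)) \<le> inverse (real (Suc N))" "inverse (real (Suc j)) \<le> inverse (real (Suc N))"
        using that by (simp_all add: le_imp_inverse_le)
      moreover have "\<lbrakk>x < 2 * (a + b); a \<le> c; b \<le> c; c < d / 4\<rbrakk> \<Longrightarrow> x < d" for x a b c d :: real
        by simp
      ultimately show "(ip_norm ip (\<lambda>x. s i x - s j x))\<^sup>2 < e\<^sup>2"
        using close[of i j] N by blast
    qed (use e in simp)
    then show "\<exists>N. \<forall>i\<ge>N. \<forall>j\<ge>N. ip_norm ip (\<lambda>x. s i x - s j x) < e" by blast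
  qed (fact sH)
  then obtain u where u: "u \<in> H" and lim: "(\<lambda>n. ip_norm ip (\<lambda>x. s n x - u x)) \<longlonglongrightarrow> 0" by blast
  have rep: "ip g u = c" if gc: "(g, c) \<in> R" for g c
  proof -
    have g: "g \<in> H" using sub[OF gc] .
    have gu: "ip g h = cnj (ip h g)" if "h \<in> H" for h using ip_commute g that by blast
    have var: "0 \<le> 2 * Re (z * (ip g u - c)) + (cmod z)\<^sup>2 * (ip_norm ip g)\<^sup>2" for z
    proof -
      have zg: "(\<lambda>x. z * g x) \<in> H" using scale_mem[OF g] .
      have "- inverse (real (Suc n)) \<le>
          2 * Re (z * (cnj (ip (s n) g) - c)) + (cmod z)\<^sup>2 * (ip_norm ip g)\<^sup>2" for n
      proof -
        have "m \<le> Q (\<lambda>x. s n x + z * g x, l n + z * c)"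
          using m_le[OF add[OF sl[of n] scale[OF gc, of z]]] .
        also have "\<dots> = Q (r n) + 2 * Re (z * (cnj (ip (s n) g) - c)) + (cmod z)\<^sup>2 * (ip_norm ip g)\<^sup>2"
          using norm_add_sq[OF sH[of n] zg] norm_scale[OF g, of z] ip_scale_right[OF g sH[of n], of z]
          by (simp add: Q_def s_def l_def power_mult_distrib algebra_simps)
        finally show ?thesis using r(2)[of n] by simp
      qed
      moreover have "(\<lambda>n. - inverse (real (Suc n))) \<longlonglongrightarrow> 0"
        using tendsto_minus[OF LIMSEQ_inverse_real_of_nat] by simp
      moreover have "(\<lambda>n. 2 * Re (z * (cnj (ip (s n) g) - c)) + (cmod z)\<^sup>2 * (ip_norm ip g)\<^sup>2)
          \<longlonglongrightarrow> 2 * Re (z * (cnj (ip u g) - c)) + (cmod z)\<^sup>2 * (ip_norm ip g)\<^sup>2"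
        by (intro tendsto_intros ip_tendsto sH u g lim)
      ultimately show ?thesis
        unfolding gu[OF u] by (meson LIMSEQ_le)
    qed
    \<comment> \<open>The first variation in direction \<open>z = - t cnj d\<close> is \<open>- 2 t |d|\<^sup>2 + t\<^sup>2 |d|\<^sup>2 G\<close>; it is negative for \<open>t = 1 / (G + 1)\<close>
      unless \<open>d = 0\<close>.\<close>
    define d where "d = ip g u - c"
    define G where "G = (ip_norm ip g)\<^sup>2"
    have G: "G \<ge> 0" by (simp add: G_def)
    have "0 \<le> 2 * Re (of_real (- 1 / (G + 1)) * cnj d * d) + (cmod (of_real (- 1 / (G + 1)) * cnj d))\<^sup>2 * G"
      using var[of "of_real (- 1 / (G + 1)) * cnj d"] by (simp add: d_def G_def)
    also have "Re (of_real (- 1 / (G + 1)) * cnj d * d) = - 1 / (G + 1) * (cmod d)\<^sup>2"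
    proof -
      have "cnj d * d = of_real ((cmod d)\<^sup>2)"
        by (simp add: mult.commute complex_norm_square del: of_real_power)
      then show ?thesis by (simp only: mult.assoc of_real_mult[symmetric] Re_complex_of_real)
    qed
    also have "(cmod (of_real (- 1 / (G + 1)) * cnj d))\<^sup>2 = (cmod d)\<^sup>2 / (G + 1)\<^sup>2"
      by (simp only: norm_mult norm_of_real complex_mod_cnj power_mult_distrib power2_abs power_divide) simp
    finally have "0 \<le> (2 * (- 1 / (G + 1) * (cmod d)\<^sup>2) + (cmod d)\<^sup>2 / (G + 1)\<^sup>2 * G) * (G + 1)\<^sup>2"
      by simp
    also have "\<dots> = (cmod d)\<^sup>2 * G - 2 * (cmod d)\<^sup>2 * (G + 1)"
    proof -
      have "(2 * (- 1 / K * D) + D / K\<^sup>2 * G) * K\<^sup>2 = D * G - 2 * D * K" if "K > 0" for K D :: real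
        using that by (simp add: field_simps power2_eq_square)
      then show ?thesis using G by simp
    qed
    finally have "(cmod d)\<^sup>2 * (G + 2) \<le> 0" by (simp add: algebra_simps)
    then have "d = 0" using G by (simp add: mult_le_0_iff)
    then show ?thesis by (simp add: d_def)
  qed
  have "(\<lambda>n. cmod (ip (s n) u)) \<longlonglongrightarrow> cmod (ip u u)"
    by (intro tendsto_norm ip_tendsto sH u lim)
  moreover have "(\<lambda>n. C * ip_norm ip (s n)) \<longlonglongrightarrow> C * ip_norm ip u"
    by (intro tendsto_mult tendsto_const norm_tendsto sH u lim)
  moreover have "cmod (ip (s n) u) \<le> C * ip_norm ip (s n)" for n
    using rep[OF sl] bound[OF sl] by simp
  ultimately have "cmod (ip u u) \<le> C * ip_norm ip u" by (meson LIMSEQ_le)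
  then have "ip_norm ip u * ip_norm ip u \<le> C * ip_norm ip u"
    by (simp add: ip_self[OF u] power2_eq_square norm_mult)
  then have "ip_norm ip u \<le> C"
    using norm_nonneg[OF u] C by (cases "ip_norm ip u = 0") auto
  then show ?thesis using u rep by blast
qed

text \<open>The uniform boundedness principle, by a gliding hump instead of a category argument. For unbounded \<open>G\<close>
pick \<open>g n\<close> of norm above \<open>4 ^ n\<close> and build a sequence \<open>x\<close> whose \<open>n\<close>-th step has length at most
\<open>(1/3) ^ n\<close> and makes the inner product with \<open>g n\<close> at least \<open>(1/3) ^ n\<close> times the norm of \<open>g n\<close>. All later
steps together have length at most half of \<open>(1/3) ^ n\<close>, so the limit still has inner products with
\<open>g n\<close> that grow like \<open>(4/3) ^ n\<close>.\<close>

lemma uniform_boundedness: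
  assumes G: "G \<subseteq> H"
    and pt: "\<And>h. h \<in> H \<Longrightarrow> \<exists>K. \<forall>g\<in>G. cmod (ip h g) \<le> K"
  shows "\<exists>M. \<forall>g\<in>G. ip_norm ip g \<le> M"
proof (rule ccontr)
  assume "\<not> ?thesis"
  then have "\<exists>g\<in>G. ip_norm ip g > 4 ^ n" for n :: nat
    by (meson not_le)
  then obtain g where gG: "\<And>n. g n \<in> G" and g: "\<And>n::nat. ip_norm ip (g n) > 4 ^ n" by metis
  have gH: "g n \<in> H" for n using gG G by blast
  have gpos: "ip_norm ip (g n) > 0" for n
    using g[of n] by (meson less_trans zero_less_numeral zero_less_power)
  define r :: "nat \<Rightarrow> real" where "r n = (1/3) ^ n" for n
  have rpos: "r n > 0" for n by (simp add: r_def)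
  have step: "\<exists>y. y \<in> H \<and> ip_norm ip (\<lambda>t. y t - x t) \<le> r n \<and> r n * ip_norm ip (g n) \<le> cmod (ip y (g n))"
    if x: "x \<in> H" for x n
  proof -
    \<comment> \<open>The inner products of \<open>x + c g\<close> and \<open>x - c g\<close> with \<open>g\<close> differ by \<open>2 r \<parallel>g\<parallel>\<close>, so one of them is large.\<close>
    define c where "c = complex_of_real (r n / ip_norm ip (g n))"
    have cg: "(\<lambda>t. c * g n t) \<in> H" using scale_mem[OF gH] .
    have ncg: "ip_norm ip (\<lambda>t. c * g n t) = r n"
      using norm_scale[OF gH[of n], of c] gpos[of n] rpos[of n] by (simp add: c_def norm_divide)
    have "ip (\<lambda>t. c * g n t) (g n) = complex_of_real (r n * ip_norm ip (g n))"
      using gpos[of n] unfolding ip_scale_left[OF gH gH] ip_self[OF gH] c_def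
      by (simp add: power2_eq_square)
    then have "2 * (r n * ip_norm ip (g n)) = cmod (2 * ip (\<lambda>t. c * g n t) (g n))"
      using gpos[of n] rpos[of n] by (simp add: norm_mult)
    also have "2 * ip (\<lambda>t. c * g n t) (g n) = ip (\<lambda>t. x t + c * g n t) (g n) - ip (\<lambda>t. x t - c * g n t) (g n)"
      by (simp add: ip_add_left[OF x cg gH] ip_diff_left[OF x cg gH])
    also have "cmod \<dots> \<le> cmod (ip (\<lambda>t. x t + c * g n t) (g n)) + cmod (ip (\<lambda>t. x t - c * g n t) (g n))"
      by (rule norm_triangle_ineq4)
    finally consider "r n * ip_norm ip (g n) \<le> cmod (ip (\<lambda>t. x t + c * g n t) (g n))"
      | "r n * ip_norm ip (g n) \<le> cmod (ip (\<lambda>t. x t - c * g n t) (g n))" by linarith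
    then show ?thesis
    proof cases
      case 1
      then show ?thesis using add_mem[OF x cg] ncg by (intro exI[of _ "\<lambda>t. x t + c * g n t"]) simp
    next
      case 2
      have "ip_norm ip (\<lambda>t. (x t - c * g n t) - x t) = r n"
        using norm_scale[OF cg, of "-1"] ncg by simp
      then show ?thesis using 2 diff_mem[OF x cg] by (intro exI[of _ "\<lambda>t. x t - c * g n t"]) simp
    qed
  qed
  have "\<exists>x. \<forall>n. x n \<in> H \<and> ip_norm ip (\<lambda>t. x (Suc n) t - x n t) \<le> r n
      \<and> r n * ip_norm ip (g n) \<le> cmod (ip (x (Suc n)) (g n))"
  proof (rule dependent_nat_choice)
    show "\<exists>x. x \<in> H" using zero_mem by (intro exI[of _ "\<lambda>_. 0"])
    show "\<exists>y. y \<in> H \<and> ip_norm ip (\<lambda>t. y t - x t) \<le> r n \<and> r n * ip_norm ip (g n) \<le> cmod (ip y (g n))"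
      if "x \<in> H" for x n using step[OF that] .
  qed
  then obtain x where x: "\<And>n. x n \<in> H" and
    xs: "\<And>n. ip_norm ip (\<lambda>t. x (Suc n) t - x n t) \<le> r n \<and> r n * ip_norm ip (g n) \<le> cmod (ip (x (Suc n)) (g n))"
    by blast
  have dist: "ip_norm ip (\<lambda>t. x (n + j) t - x n t) \<le> 3/2 * (r n - r (n + j))" for n j
  proof (induction j)
    case 0
    show ?case using norm_scale[OF zero_mem, of 0] by simp
  next
    case (Suc j)
    have "r (n + Suc j) = r (n + j) / 3" by (simp add: r_def)
    then show ?case
      using norm_diff_triangle[OF x[of "n + Suc j"] x[of "n + j"] x[of n]] conjunct1[OF xs[of "n + j"]] Suc
      unfolding add_Suc_right by argo
  qed
  have dist': "ip_norm ip (\<lambda>t. x i t - x n t) \<le> 3/2 * r n" if "i \<ge> n" for i n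
    using dist[of n "i - n"] rpos[of i] that by simp
  have r0: "r \<longlonglongrightarrow> 0" unfolding r_def by (rule LIMSEQ_realpow_zero) auto
  have "\<exists>u\<in>H. (\<lambda>n::nat. ip_norm ip (\<lambda>t. x n t - u t)) \<longlonglongrightarrow> 0"
  proof (rule complete)
    fix e :: real assume "e > 0"
    then have "\<forall>\<^sub>F n in sequentially. r n < e / 3"
      by (intro order_tendstoD(2)[OF r0]) simp
    then obtain N where N: "r N < e / 3" by (auto simp: eventually_sequentially)
    have "ip_norm ip (\<lambda>t. x i t - x j t) < e" if "i \<ge> N" "j \<ge> N" for i j
      using norm_diff_triangle[OF x[of i] x[of N] x[of j]] dist'[OF that(1)] dist'[OF that(2)]
        norm_diff_commute[OF x[of j] x[of N]] N by simp
    then show "\<exists>N. \<forall>i\<ge>N. \<forall>j\<ge>N. ip_norm ip (\<lambda>t. x i t - x j t) < e" by blast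
  qed (fact x)
  then obtain u where u: "u \<in> H" and lim: "(\<lambda>n. ip_norm ip (\<lambda>t. x n t - u t)) \<longlonglongrightarrow> 0" by blast
  have far: "ip_norm ip (\<lambda>t. x n t - u t) \<le> 3/2 * r n" for n
  proof (rule LIMSEQ_le_const[of "\<lambda>i. ip_norm ip (\<lambda>t. x i t - u t) + 3/2 * r n"])
    show "(\<lambda>i. ip_norm ip (\<lambda>t. x i t - u t) + 3/2 * r n) \<longlonglongrightarrow> 3/2 * r n"
      using tendsto_add[OF lim tendsto_const, of "3/2 * r n"] by simp
    have "ip_norm ip (\<lambda>t. x n t - u t) \<le> ip_norm ip (\<lambda>t. x i t - u t) + 3/2 * r n" if "i \<ge> n" for i
      using norm_diff_triangle[OF x[of n] x[of i] u] dist'[OF that] norm_diff_commute[OF x[of n] x[of i]]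
      by simp
    then show "\<exists>N. \<forall>i\<ge>N. ip_norm ip (\<lambda>t. x n t - u t) \<le> ip_norm ip (\<lambda>t. x i t - u t) + 3/2 * r n"
      by blast
  qed
  have large: "(4/3) ^ n / 2 \<le> cmod (ip u (g n))" for n
  proof -
    have "r n * ip_norm ip (g n) \<le> cmod (ip (x (Suc n)) (g n))" using xs by blast
    also have "\<dots> = cmod (ip u (g n) + ip (\<lambda>t. x (Suc n) t - u t) (g n))"
      by (simp add: ip_diff_left x u gH)
    also have "\<dots> \<le> cmod (ip u (g n)) + cmod (ip (\<lambda>t. x (Suc n) t - u t) (g n))"
      by (rule norm_triangle_ineq)
    also have "cmod (ip (\<lambda>t. x (Suc n) t - u t) (g n)) \<le> (r n / 2) * ip_norm ip (g n)"
    proof -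
      have "ip_norm ip (\<lambda>t. x (Suc n) t - u t) \<le> r n / 2"
        using far[of "Suc n"] by (simp add: r_def)
      then show ?thesis
        using cauchy_schwarz[OF diff_mem[OF x u] gH, of "Suc n" n] gpos[of n]
        by (meson less_imp_le mult_right_mono order_trans)
    qed
    finally have "r n / 2 * ip_norm ip (g n) \<le> cmod (ip u (g n))" by simp
    moreover have "r n / 2 * 4 ^ n \<le> r n / 2 * ip_norm ip (g n)"
      using g[of n] rpos[of n] by simp
    moreover have "r n / 2 * 4 ^ n = (4/3) ^ n / 2"
      by (simp add: r_def power_divide)
    ultimately show ?thesis by linarith
  qed
  obtain K where K: "\<And>n. cmod (ip u (g n)) \<le> K" using pt[OF u] gG by blast
  obtain n where "(4/3 :: real) ^ n > 2 * K" using real_arch_pow[of "4/3" "2 * K"] by auto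
  then show False using large[of n] K[of n] by linarith
qed

end

section \<open>Composition operators on reproducing kernel Hilbert spaces\<close>

text \<open>Linear combinations are indexed by lists of pairs, so that repeated points are allowed: addition is
concatenation, and moving the points is a \<open>map\<close> even if the map is not injective. With \<open>e = k\<close> these are
the finite kernel sums, with \<open>e\<close> the characters below the trigonometric polynomials.\<close>

definition lincomb :: "('a \<Rightarrow> 'b \<Rightarrow> complex) \<Rightarrow> (complex \<times> 'a) list \<Rightarrow> 'b \<Rightarrow> complex" where
  "lincomb e L = (\<lambda>y. \<Sum>(a, x)\<leftarrow>L. a * e x y)"

lemma lincomb_Nil [simp]: "lincomb e [] = (\<lambda>_. 0)"
  by (simp add: lincomb_def)

lemma lincomb_Cons [simp]: "lincomb e ((a, x) # L) = (\<lambda>y. a * e x y + lincomb e L y)"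
  by (simp add: lincomb_def)

lemma lincomb_append [simp]: "lincomb e (L @ L') = (\<lambda>y. lincomb e L y + lincomb e L' y)"
  by (simp add: lincomb_def)

lemma lincomb_scale: "lincomb e (map (\<lambda>(a, x). (c * a, x)) L) = (\<lambda>y. c * lincomb e L y)"
  by (induction L) (auto simp: algebra_simps)

lemma sum_list_lincomb_scale:
  "(\<Sum>(a, x)\<leftarrow>map (\<lambda>(a, x). (c * a, x)) L. a * u x) = c * (\<Sum>(a, x)\<leftarrow>L. a * (u x :: complex))"
  by (induction L) (auto simp: algebra_simps)

lemma sum_list_cnj:
  "(\<Sum>(a, x)\<leftarrow>L. cnj a * u x) = cnj (\<Sum>(a, x)\<leftarrow>L. a * cnj (u x))"
  by (induction L) auto

context rkhs begin

lemma lincomb_mem: "lincomb (\<lambda>x. k (\<phi> x)) L \<in> H"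
  by (induction L) (auto simp: zero_mem intro!: add_mem scale_mem kernel_mem)

lemma lincomb_kernel_mem: "lincomb k L \<in> H"
  using lincomb_mem[of "\<lambda>x. x"] by simp

lemma ip_lincomb:
  assumes "h \<in> H"
  shows "ip h (lincomb (\<lambda>x. k (\<phi> x)) L) = (\<Sum>(a, x)\<leftarrow>L. cnj a * h (\<phi> x))"
proof (induction L)
  case (Cons p L)
  obtain a x where p: "p = (a, x)" by (cases p)
  then show ?case
    using Cons.IH by (simp add: ip_add_right[OF scale_mem[OF kernel_mem] lincomb_mem assms]
        ip_scale_right[OF kernel_mem assms] reproducing[OF assms])
qed (simp add: ip_zero_right assms)

text \<open>The bound says that \<open>\<Sum> a\<^sub>i k\<^bsub>x\<^sub>i\<^esub> \<mapsto> \<Sum> a\<^sub>i cnj (h x\<^sub>i)\<close> is a bounded functional on the kernel sums. The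
vector \<open>u\<close> that represents it satisfies \<open>u x = ip u (k x) = h x\<close>. This is how a function is shown to
belong to \<open>H\<close>.\<close>

lemma mem_if_bounded_on_kernels:
  assumes "C \<ge> 0"
    and bound: "\<And>L. cmod (\<Sum>(a, x)\<leftarrow>L. cnj a * h x) \<le> C * ip_norm ip (lincomb k L)"
  shows "h \<in> H \<and> ip_norm ip h \<le> C"
proof -
  define R where "R = range (\<lambda>L. (lincomb k L, \<Sum>(a, x)\<leftarrow>L. a * cnj (h x)))"
  have "\<exists>u\<in>H. (\<forall>g l. (g, l) \<in> R \<longrightarrow> ip g u = l) \<and> ip_norm ip u \<le> C"
  proof (rule riesz_relation[of R C])
    show "R \<noteq> {}" by (simp add: R_def)
    show "g \<in> H" if "(g, l) \<in> R" for g l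
      using that lincomb_kernel_mem by (auto simp: R_def)
    show "(\<lambda>x. g x + g' x, l + l') \<in> R" if gl: "(g, l) \<in> R" "(g', l') \<in> R" for g l g' l'
    proof -
      obtain L L' where "g = lincomb k L" "l = (\<Sum>(a, x)\<leftarrow>L. a * cnj (h x))"
          "g' = lincomb k L'" "l' = (\<Sum>(a, x)\<leftarrow>L'. a * cnj (h x))"
        using gl by (auto simp: R_def)
      then show ?thesis by (auto simp: R_def intro!: image_eqI[of _ _ "L @ L'"])
    qed
    show "(\<lambda>x. c * g x, c * l) \<in> R" if gl: "(g, l) \<in> R" for g l c
    proof -
      obtain L where L: "g = lincomb k L" "l = (\<Sum>(a, x)\<leftarrow>L. a * cnj (h x))"
        using gl by (auto simp: R_def)
      show ?thesis unfolding R_def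
        by (rule image_eqI[of _ _ "map (\<lambda>(a, x). (c * a, x)) L"])
          (simp_all only: L lincomb_scale sum_list_lincomb_scale UNIV_I)
    qed
    show "cmod l \<le> C * ip_norm ip g" if gl: "(g, l) \<in> R" for g l
    proof -
      obtain L where L: "g = lincomb k L" "l = (\<Sum>(a, x)\<leftarrow>L. a * cnj (h x))"
        using gl by (auto simp: R_def)
      have "cmod l = cmod (\<Sum>(a, x)\<leftarrow>L. cnj a * h x)"
        by (simp only: sum_list_cnj L complex_mod_cnj)
      then show ?thesis using bound[of L] L by simp
    qed
  qed (fact \<open>C \<ge> 0\<close>)
  then obtain u where u: "u \<in> H" "\<And>g l. (g, l) \<in> R \<Longrightarrow> ip g u = l" "ip_norm ip u \<le> C"
    by blast
  have "u x = h x" for x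
  proof -
    have "(k x, cnj (h x)) \<in> R"
      by (auto simp: R_def intro!: image_eqI[of _ _ "[(1, x)]"])
    then have "ip u (k x) = h x"
      using u(2) ip_commute[OF u(1) kernel_mem[of x]] by simp
    then show ?thesis using reproducing[OF u(1)] by simp
  qed
  then have "u = h" by blast
  then show ?thesis using u(1,3) by simp
qed

text \<open>The hypothesis says that the adjoint \<open>k x \<mapsto> k (f x)\<close> is well defined and bounded on kernel sums. Then
\<open>\<Sum> cnj a\<^sub>i * h (f x\<^sub>i)\<close>, the inner product of \<open>h\<close> with the image of \<open>\<Sum> a\<^sub>i k x\<^sub>i\<close>, is at most a multiple of
the norm of that sum, which puts \<open>h \<circ> f\<close> into \<open>H\<close>.\<close>

lemma comp_op_bounded_if:
  assumes "M \<ge> 0"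
    and le: "\<And>L. ip_norm ip (lincomb (\<lambda>x. k (f x)) L) \<le> M * ip_norm ip (lincomb k L)"
  shows "bounded_operator_on H ip (comp_op f)"
proof -
  have "h \<circ> f \<in> H \<and> ip_norm ip (h \<circ> f) \<le> M * ip_norm ip h" if h: "h \<in> H" for h
  proof (rule mem_if_bounded_on_kernels)
    show "0 \<le> M * ip_norm ip h" using norm_nonneg[OF h] \<open>M \<ge> 0\<close> by simp
    fix L
    have "cmod (\<Sum>(a, x)\<leftarrow>L. cnj a * (h \<circ> f) x) = cmod (ip h (lincomb (\<lambda>x. k (f x)) L))"
      by (simp add: ip_lincomb[OF h])
    also have "\<dots> \<le> ip_norm ip h * ip_norm ip (lincomb (\<lambda>x. k (f x)) L)"
      by (rule cauchy_schwarz[OF h lincomb_mem])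
    also have "\<dots> \<le> ip_norm ip h * (M * ip_norm ip (lincomb k L))"
      by (intro mult_left_mono le norm_nonneg h)
    finally show "cmod (\<Sum>(a, x)\<leftarrow>L. cnj a * (h \<circ> f) x) \<le> M * ip_norm ip h * ip_norm ip (lincomb k L)"
      by (simp add: mult_ac)
  qed
  then show ?thesis by (auto simp: bounded_operator_on_def comp_op_def)
qed

text \<open>A closed graph theorem: \<open>ip h (\<Sum> a\<^sub>i k\<^bsub>f x\<^sub>i\<^esub>) = ip (h \<circ> f) (\<Sum> a\<^sub>i k\<^bsub>x\<^sub>i\<^esub>)\<close> is bounded for each \<open>h\<close>
as the kernel sum on the right ranges over the unit ball, so uniform boundedness applies to the sums on
the left.\<close>

lemma bounded_if_comp_dom_full:
  assumes full: "comp_dom H f = H"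
  obtains M where "M \<ge> 0"
    "\<And>L. ip_norm ip (lincomb (\<lambda>x. k (f x)) L) \<le> M * ip_norm ip (lincomb k L)"
proof -
  define G where "G = {lincomb (\<lambda>x. k (f x)) L | L. ip_norm ip (lincomb k L) \<le> 1}"
  have "\<exists>M. \<forall>g\<in>G. ip_norm ip g \<le> M"
  proof (rule uniform_boundedness)
    show "G \<subseteq> H" using lincomb_mem by (auto simp: G_def)
    fix h assume h: "h \<in> H"
    then have hf: "h \<circ> f \<in> H" using full by (auto simp: comp_dom_def comp_op_def)
    have "cmod (ip h (lincomb (\<lambda>x. k (f x)) L)) \<le> ip_norm ip (h \<circ> f)"
      if "ip_norm ip (lincomb k L) \<le> 1" for L
    proof -
      have "ip h (lincomb (\<lambda>x. k (f x)) L) = ip (h \<circ> f) (lincomb k L)"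
        using ip_lincomb[OF h, of f L] ip_lincomb[OF hf, of "\<lambda>x. x" L] by simp
      also have "cmod \<dots> \<le> ip_norm ip (h \<circ> f) * ip_norm ip (lincomb k L)"
        by (rule cauchy_schwarz[OF hf lincomb_kernel_mem])
      also have "\<dots> \<le> ip_norm ip (h \<circ> f)"
        using that norm_nonneg[OF hf] by (simp add: mult_left_le)
      finally show ?thesis .
    qed
    then show "\<exists>K. \<forall>g\<in>G. cmod (ip h g) \<le> K" by (auto simp: G_def)
  qed
  then obtain M where M: "\<And>g. g \<in> G \<Longrightarrow> ip_norm ip g \<le> M" by blast
  have M': "t * ip_norm ip (lincomb (\<lambda>x. k (f x)) L) \<le> M"
    if "t * ip_norm ip (lincomb k L) \<le> 1" "t \<ge> 0" for t L
  proof -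
    let ?L = "map (\<lambda>(a, x). (complex_of_real t * a, x)) L"
    have "ip_norm ip (lincomb k ?L) \<le> 1"
      using that norm_scale[OF lincomb_kernel_mem, of "complex_of_real t" L] by (simp add: lincomb_scale)
    then have "ip_norm ip (lincomb (\<lambda>x. k (f x)) ?L) \<le> M"
      by (intro M) (auto simp: G_def)
    then show ?thesis
      using that norm_scale[OF lincomb_mem, of "complex_of_real t" f L] by (simp add: lincomb_scale)
  qed
  have "M \<ge> 0" using M'[of 0 "[]"] by simp
  moreover have "ip_norm ip (lincomb (\<lambda>x. k (f x)) L) \<le> M * ip_norm ip (lincomb k L)" for L
  proof (rule field_le_epsilon)
    fix e :: real assume e: "e > 0"
    \<comment> \<open>Scaling by \<open>1 / s\<close> with \<open>s\<close> slightly above the norm also covers kernel sums of norm 0.\<close>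
    define s where "s = ip_norm ip (lincomb k L) + e / (M + 1)"
    have "s > ip_norm ip (lincomb k L)" "ip_norm ip (lincomb k L) \<ge> 0"
      using e \<open>M \<ge> 0\<close> norm_nonneg[OF lincomb_kernel_mem] by (simp_all add: s_def)
    then have "ip_norm ip (lincomb (\<lambda>x. k (f x)) L) \<le> M * s"
      using M'[of "1 / s" L] by (simp add: field_simps)
    also have "\<dots> \<le> M * ip_norm ip (lincomb k L) + e"
      using \<open>M \<ge> 0\<close> e by (simp add: s_def field_simps)
    finally show "ip_norm ip (lincomb (\<lambda>x. k (f x)) L) \<le> M * ip_norm ip (lincomb k L) + e" .
  qed
  ultimately show thesis using that by blast
qed

end

section \<open>Square-mean approximation by trigonometric polynomials\<close>

definition character :: "'a::euclidean_space \<Rightarrow> 'a \<Rightarrow> complex" where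
  "character x \<xi> = cis (- 2 * pi * (\<xi> \<bullet> x))"

lemma character_add: "character (x + y) \<xi> = character x \<xi> * character y \<xi>"
  by (simp add: character_def cis_mult algebra_simps)

lemma cnj_character: "cnj (character x \<xi>) = character (- x) \<xi>"
  by (simp add: character_def cis_cnj)

lemma character_0 [simp]: "character 0 \<xi> = 1"
  by (simp add: character_def)

lemma norm_character [simp]: "cmod (character x \<xi>) = 1"
  by (simp add: character_def)

lemma measurable_character [measurable]: "character x \<in> borel_measurable borel"
  unfolding character_def cis_conv_exp
  by (intro borel_measurable_continuous_onI continuous_intros)

lemma measurable_trig [measurable]: "lincomb character L \<in> borel_measurable borel"
  by (induction L) auto

lemma trig_bounded: "\<exists>B. \<forall>\<xi>. cmod (lincomb character L \<xi>) \<le> B"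
proof (induction L)
  case (Cons p L)
  obtain a x where p: "p = (a, x)" by (cases p)
  obtain B where B: "\<And>\<xi>. cmod (lincomb character L \<xi>) \<le> B" using Cons by blast
  have "cmod (lincomb character (p # L) \<xi>) \<le> cmod a + B" for \<xi>
    using norm_triangle_ineq[of "a * character x \<xi>" "lincomb character L \<xi>"] B[of \<xi>]
    by (simp add: p norm_mult)
  then show ?case by blast
qed auto

lemma lincomb_character_shift:
  "lincomb character (map (\<lambda>(a, y). (a, x + y)) L) = (\<lambda>\<xi>. character x \<xi> * lincomb character L \<xi>)"
  by (induction L) (auto simp: algebra_simps character_add)

text \<open>A substitute for the triangle inequality in \<open>L\<^sup>2\<close> that stays with integrals of squared norms.\<close>

lemma norm_diff_sq_le: "(norm (a - c))\<^sup>2 \<le> 2 * (norm (a - b))\<^sup>2 + 2 * (norm (b - c))\<^sup>2"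
proof -
  have "norm (a - c) \<le> norm (a - b) + norm (b - c)"
    using norm_triangle_ineq[of "a - b" "b - c"] by simp
  then have "(norm (a - c))\<^sup>2 \<le> (norm (a - b) + norm (b - c))\<^sup>2" by (simp add: power_mono)
  also have "\<dots> \<le> 2 * (norm (a - b))\<^sup>2 + 2 * (norm (b - c))\<^sup>2"
    using sum_squares_bound[of "norm (a - b)" "norm (b - c)"] by (simp add: power2_sum)
  finally show ?thesis .
qed

text \<open>The bounded functions in the \<open>L\<^sup>2\<close> closure of the trigonometric polynomials, where one polynomial has
to serve for all measures in \<open>Ms\<close>. Boundedness makes this class an algebra.\<close>

definition trig_closure :: "'a::euclidean_space measure set \<Rightarrow> ('a \<Rightarrow> complex) set" where
  "trig_closure Ms = {p \<in> borel_measurable borel. bounded (range p) \<and>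
     (\<forall>e>0. \<exists>L. \<forall>M\<in>Ms. (\<integral>\<xi>. (cmod (p \<xi> - lincomb character L \<xi>))\<^sup>2 \<partial>M) < e)}"

locale finite_borel_measures =
  fixes Ms :: "'a::euclidean_space measure set"
  assumes finite_Ms: "finite Ms"
    and finite_measure_Ms: "\<And>M. M \<in> Ms \<Longrightarrow> finite_measure M"
    and sets_Ms: "\<And>M. M \<in> Ms \<Longrightarrow> sets M = sets borel"
begin

lemma integrable_sq_diff:
  fixes p q :: "'a \<Rightarrow> complex"
  assumes M: "M \<in> Ms" and [measurable]: "p \<in> borel_measurable borel" "q \<in> borel_measurable borel"
    and "bounded (range p)" "bounded (range q)"
  shows "integrable M (\<lambda>\<xi>. (cmod (p \<xi> - q \<xi>))\<^sup>2)"
proof -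
  interpret finite_measure M by (rule finite_measure_Ms[OF M])
  have [measurable_cong]: "sets M = sets borel" by (rule sets_Ms[OF M])
  obtain B C where B: "\<And>\<xi>. cmod (p \<xi>) \<le> B" and C: "\<And>\<xi>. cmod (q \<xi>) \<le> C"
    using assms(4,5) unfolding bounded_iff by (metis rangeI)
  have "cmod (p \<xi> - q \<xi>) \<le> B + C" for \<xi>
    using norm_triangle_ineq4[of "p \<xi>" "q \<xi>"] B[of \<xi>] C[of \<xi>] by linarith
  then have "norm ((cmod (p \<xi> - q \<xi>))\<^sup>2) \<le> (B + C)\<^sup>2" for \<xi> by (simp add: power_mono)
  then show ?thesis by (intro integrable_const_bound[of _ "(B + C)\<^sup>2"]) auto
qed

lemma trig_bounded_range: "bounded (range (lincomb character L))"
  using trig_bounded[of L] by (auto simp: bounded_iff)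

lemma integral_sq_diff_le:
  fixes p q r :: "'a \<Rightarrow> complex"
  assumes M: "M \<in> Ms"
    and p: "p \<in> borel_measurable borel" "bounded (range p)"
    and q: "q \<in> borel_measurable borel" "bounded (range q)"
    and r: "r \<in> borel_measurable borel" "bounded (range r)"
  shows "(\<integral>\<xi>. (cmod (p \<xi> - r \<xi>))\<^sup>2 \<partial>M)
    \<le> 2 * (\<integral>\<xi>. (cmod (p \<xi> - q \<xi>))\<^sup>2 \<partial>M) + 2 * (\<integral>\<xi>. (cmod (q \<xi> - r \<xi>))\<^sup>2 \<partial>M)"
proof -
  have i: "integrable M (\<lambda>\<xi>. (cmod (p \<xi> - r \<xi>))\<^sup>2)" "integrable M (\<lambda>\<xi>. (cmod (p \<xi> - q \<xi>))\<^sup>2)"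
      "integrable M (\<lambda>\<xi>. (cmod (q \<xi> - r \<xi>))\<^sup>2)"
    using M p q r by (blast intro: integrable_sq_diff)+
  have "(\<integral>\<xi>. (cmod (p \<xi> - r \<xi>))\<^sup>2 \<partial>M)
    \<le> (\<integral>\<xi>. 2 * (cmod (p \<xi> - q \<xi>))\<^sup>2 + 2 * (cmod (q \<xi> - r \<xi>))\<^sup>2 \<partial>M)"
    using i by (intro integral_mono norm_diff_sq_le) auto
  also have "\<dots> = 2 * (\<integral>\<xi>. (cmod (p \<xi> - q \<xi>))\<^sup>2 \<partial>M) + 2 * (\<integral>\<xi>. (cmod (q \<xi> - r \<xi>))\<^sup>2 \<partial>M)"
    using i by simp
  finally show ?thesis .
qed

lemma trig_closureD:
  assumes "p \<in> trig_closure Ms"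
  shows "p \<in> borel_measurable borel" "bounded (range p)"
    "e > 0 \<Longrightarrow> \<exists>L. \<forall>M\<in>Ms. (\<integral>\<xi>. (cmod (p \<xi> - lincomb character L \<xi>))\<^sup>2 \<partial>M) < e"
  using assms by (auto simp: trig_closure_def)

lemma trig_closure_closed:
  assumes p: "p \<in> borel_measurable borel" "bounded (range p)"
    and approx: "\<And>e. e > 0 \<Longrightarrow> \<exists>q\<in>trig_closure Ms. \<forall>M\<in>Ms. (\<integral>\<xi>. (cmod (p \<xi> - q \<xi>))\<^sup>2 \<partial>M) < e"
  shows "p \<in> trig_closure Ms"
proof -
  have "\<exists>L. \<forall>M\<in>Ms. (\<integral>\<xi>. (cmod (p \<xi> - lincomb character L \<xi>))\<^sup>2 \<partial>M) < e" if e: "e > 0" for e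
  proof -
    obtain q where q: "q \<in> trig_closure Ms" and pq: "\<And>M. M \<in> Ms \<Longrightarrow> (\<integral>\<xi>. (cmod (p \<xi> - q \<xi>))\<^sup>2 \<partial>M) < e / 4"
      using approx[of "e / 4"] e by auto
    obtain L where L: "\<And>M. M \<in> Ms \<Longrightarrow> (\<integral>\<xi>. (cmod (q \<xi> - lincomb character L \<xi>))\<^sup>2 \<partial>M) < e / 4"
      using trig_closureD(3)[OF q, of "e / 4"] e by auto
    have "(\<integral>\<xi>. (cmod (p \<xi> - lincomb character L \<xi>))\<^sup>2 \<partial>M) < e" if "M \<in> Ms" for M
      using integral_sq_diff_le[OF that p trig_closureD(1,2)[OF q] measurable_trig[of L] trig_bounded_range]
        pq[OF that] L[OF that] by linarith
    then show ?thesis by blast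
  qed
  then show ?thesis using p by (simp add: trig_closure_def)
qed

text \<open>Dominated convergence; finiteness of \<open>Ms\<close> yields one index \<open>n\<close> that is good for all measures.\<close>

lemma trig_closure_tendsto:
  assumes q: "\<And>n::nat. q n \<in> trig_closure Ms"
    and bound: "\<And>n \<xi>. cmod (q n \<xi>) \<le> B"
    and lim: "\<And>\<xi>. (\<lambda>n. q n \<xi>) \<longlonglongrightarrow> p \<xi>"
  shows "p \<in> trig_closure Ms"
proof (rule trig_closure_closed)
  have [measurable]: "q n \<in> borel_measurable borel" for n using trig_closureD(1)[OF q] .
  show [measurable]: "p \<in> borel_measurable borel"
    by (rule borel_measurable_LIMSEQ_metric[of q]) (use lim in auto)
  have pB: "cmod (p \<xi>) \<le> B" for \<xi>
    using bound by (intro LIMSEQ_le_const2[OF tendsto_norm[OF lim]]) auto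
  then show "bounded (range p)" by (auto simp: bounded_iff)
  fix e :: real assume e: "e > 0"
  have conv: "(\<lambda>n. \<integral>\<xi>. (cmod (p \<xi> - q n \<xi>))\<^sup>2 \<partial>M) \<longlonglongrightarrow> 0" if M: "M \<in> Ms" for M
  proof -
    interpret finite_measure M by (rule finite_measure_Ms[OF M])
    have [measurable_cong]: "sets M = sets borel" by (rule sets_Ms[OF M])
    have "(\<lambda>n. \<integral>\<xi>. (cmod (p \<xi> - q n \<xi>))\<^sup>2 \<partial>M) \<longlonglongrightarrow> (\<integral>\<xi>. 0 \<partial>M)"
    proof (rule integral_dominated_convergence[where w = "\<lambda>_. (B + B)\<^sup>2"])
      have "(\<lambda>n. (cmod (p \<xi> - q n \<xi>))\<^sup>2) \<longlonglongrightarrow> (cmod (p \<xi> - p \<xi>))\<^sup>2" for \<xi>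
        by (intro tendsto_intros lim)
      then show "AE \<xi> in M. (\<lambda>n. (cmod (p \<xi> - q n \<xi>))\<^sup>2) \<longlonglongrightarrow> 0" by simp
      have "cmod (p \<xi> - q n \<xi>) \<le> B + B" for n \<xi>
        using norm_triangle_ineq4[of "p \<xi>" "q n \<xi>"] pB[of \<xi>] bound[of n \<xi>] by linarith
      then have "(cmod (p \<xi> - q n \<xi>))\<^sup>2 \<le> (B + B)\<^sup>2" for n \<xi>
        by (intro power_mono norm_ge_zero)
      then show "AE \<xi> in M. norm ((cmod (p \<xi> - q n \<xi>))\<^sup>2) \<le> (B + B)\<^sup>2" for n
        by (intro AE_I2) (simp only: real_norm_def abs_power2)
    qed auto
    then show ?thesis by simp
  qed
  have "\<forall>\<^sub>F n in sequentially. \<forall>M\<in>Ms. (\<integral>\<xi>. (cmod (p \<xi> - q n \<xi>))\<^sup>2 \<partial>M) < e"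
    using order_tendstoD(2)[OF conv e] finite_Ms by (intro eventually_ball_finite) auto
  then obtain n where "\<forall>M\<in>Ms. (\<integral>\<xi>. (cmod (p \<xi> - q n \<xi>))\<^sup>2 \<partial>M) < e"
    by (auto simp: eventually_sequentially)
  then show "\<exists>q\<in>trig_closure Ms. \<forall>M\<in>Ms. (\<integral>\<xi>. (cmod (p \<xi> - q \<xi>))\<^sup>2 \<partial>M) < e"
    using q by blast
qed

lemma trig_closure_trig: "lincomb character L \<in> trig_closure Ms"
  using trig_bounded_range by (auto simp: trig_closure_def intro!: exI[of _ L])

lemma trig_closure_add:
  assumes p: "p \<in> trig_closure Ms" and q: "q \<in> trig_closure Ms"
  shows "(\<lambda>\<xi>. p \<xi> + q \<xi>) \<in> trig_closure Ms"
proof -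
  note [measurable] = trig_closureD(1)[OF p] trig_closureD(1)[OF q]
  have bdd: "bounded (range (\<lambda>\<xi>. p \<xi> + q \<xi>))"
    by (intro bounded_plus_comp trig_closureD(2) p q)
  have "\<exists>L. \<forall>M\<in>Ms. (\<integral>\<xi>. (cmod (p \<xi> + q \<xi> - lincomb character L \<xi>))\<^sup>2 \<partial>M) < e" if e: "e > 0" for e
  proof -
    obtain K where K: "\<And>M. M \<in> Ms \<Longrightarrow> (\<integral>\<xi>. (cmod (p \<xi> - lincomb character K \<xi>))\<^sup>2 \<partial>M) < e / 4"
      using trig_closureD(3)[OF p, of "e / 4"] e by auto
    obtain L where L: "\<And>M. M \<in> Ms \<Longrightarrow> (\<integral>\<xi>. (cmod (q \<xi> - lincomb character L \<xi>))\<^sup>2 \<partial>M) < e / 4"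
      using trig_closureD(3)[OF q, of "e / 4"] e by auto
    have "(\<integral>\<xi>. (cmod (p \<xi> + q \<xi> - lincomb character (K @ L) \<xi>))\<^sup>2 \<partial>M) < e" if M: "M \<in> Ms" for M
    proof -
      have "(\<integral>\<xi>. (cmod (p \<xi> + q \<xi> - lincomb character (K @ L) \<xi>))\<^sup>2 \<partial>M) \<le>
        2 * (\<integral>\<xi>. (cmod ((p \<xi> + q \<xi>) - (lincomb character K \<xi> + q \<xi>)))\<^sup>2 \<partial>M)
        + 2 * (\<integral>\<xi>. (cmod ((lincomb character K \<xi> + q \<xi>) - lincomb character (K @ L) \<xi>))\<^sup>2 \<partial>M)"
        by (intro integral_sq_diff_le[OF M] bdd trig_bounded_range bounded_plus_comp trig_closureD(2)[OF q])
          measurable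
      then show ?thesis using K[OF M] L[OF M] by simp
    qed
    then show ?thesis by blast
  qed
  then show ?thesis using bdd by (simp add: trig_closure_def)
qed

lemma trig_closure_mult_trig_single:
  assumes p: "p \<in> trig_closure Ms"
  shows "(\<lambda>\<xi>. c * character x \<xi> * p \<xi>) \<in> trig_closure Ms"
proof -
  note [measurable] = trig_closureD(1)[OF p]
  obtain B where B: "\<And>\<xi>. cmod (p \<xi>) \<le> B"
    using trig_closureD(2)[OF p] unfolding bounded_iff by (metis rangeI)
  have "bounded (range (\<lambda>\<xi>. c * character x \<xi> * p \<xi>))"
    unfolding bounded_iff by (rule exI[of _ "cmod c * B"]) (auto simp: norm_mult B mult_left_mono)
  moreover have "\<exists>L. \<forall>M\<in>Ms. (\<integral>\<xi>. (cmod (c * character x \<xi> * p \<xi> - lincomb character L \<xi>))\<^sup>2 \<partial>M) < e"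
    if e: "e > 0" for e
  proof -
    obtain L where L: "\<And>M. M \<in> Ms \<Longrightarrow>
        (\<integral>\<xi>. (cmod (p \<xi> - lincomb character L \<xi>))\<^sup>2 \<partial>M) < e / ((cmod c)\<^sup>2 + 1)"
      using trig_closureD(3)[OF p, of "e / ((cmod c)\<^sup>2 + 1)"] e by (auto simp: add_nonneg_pos)
    define K where "K = map (\<lambda>(a, y). (c * a, y)) (map (\<lambda>(a, y). (a, x + y)) L)"
    have "(\<integral>\<xi>. (cmod (c * character x \<xi> * p \<xi> - lincomb character K \<xi>))\<^sup>2 \<partial>M) < e" if M: "M \<in> Ms" for M
    proof -
      have "cmod (c * character x \<xi> * p \<xi> - lincomb character K \<xi>)
          = cmod c * cmod (p \<xi> - lincomb character L \<xi>)" for \<xi>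
        unfolding K_def lincomb_scale lincomb_character_shift
        by (simp add: right_diff_distrib[symmetric] mult.assoc norm_mult)
      then have "(\<integral>\<xi>. (cmod (c * character x \<xi> * p \<xi> - lincomb character K \<xi>))\<^sup>2 \<partial>M)
          = (cmod c)\<^sup>2 * (\<integral>\<xi>. (cmod (p \<xi> - lincomb character L \<xi>))\<^sup>2 \<partial>M)"
        by (simp add: power_mult_distrib)
      also have "\<dots> \<le> (cmod c)\<^sup>2 * (e / ((cmod c)\<^sup>2 + 1))"
        using L[OF M] by (intro mult_left_mono) auto
      also have "\<dots> < e"
        using e by (simp add: divide_simps add_nonneg_pos)
      finally show ?thesis .
    qed
    then show ?thesis by blast
  qed
  ultimately show ?thesis by (simp add: trig_closure_def)
qed

lemma trig_closure_scale: "p \<in> trig_closure Ms \<Longrightarrow> (\<lambda>\<xi>. c * p \<xi>) \<in> trig_closure Ms"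
  using trig_closure_mult_trig_single[of p c 0] by simp

lemma trig_closure_const: "(\<lambda>_. c) \<in> trig_closure Ms"
  using trig_closure_trig[of "[(c, 0)]"] by simp

lemma trig_closure_diff:
  "\<lbrakk>p \<in> trig_closure Ms; q \<in> trig_closure Ms\<rbrakk> \<Longrightarrow> (\<lambda>\<xi>. p \<xi> - q \<xi>) \<in> trig_closure Ms"
  using trig_closure_add[of p "\<lambda>\<xi>. (-1) * q \<xi>"] trig_closure_scale[of q "-1"] by simp

lemma trig_closure_mult_trig:
  assumes p: "p \<in> trig_closure Ms"
  shows "(\<lambda>\<xi>. p \<xi> * lincomb character L \<xi>) \<in> trig_closure Ms"
proof (induction L)
  case Nil
  show ?case using trig_closure_const[of 0] by simp
next
  case (Cons q L)
  obtain a x where q: "q = (a, x)" by (cases q)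
  show ?case
    using trig_closure_add[OF trig_closure_mult_trig_single[OF p, of a x] Cons]
    by (simp add: q algebra_simps)
qed

text \<open>Replace \<open>q\<close> by a trigonometric polynomial first: the error is controlled because \<open>p\<close> is bounded, and
\<open>p\<close> times a trigonometric polynomial is already known to be in the class.\<close>

lemma trig_closure_mult:
  assumes p: "p \<in> trig_closure Ms" and q: "q \<in> trig_closure Ms"
  shows "(\<lambda>\<xi>. p \<xi> * q \<xi>) \<in> trig_closure Ms"
proof (rule trig_closure_closed)
  note [measurable] = trig_closureD(1)[OF p] trig_closureD(1)[OF q]
  show "(\<lambda>\<xi>. p \<xi> * q \<xi>) \<in> borel_measurable borel" by measurable
  obtain B where B: "\<And>\<xi>. cmod (p \<xi>) \<le> B"
    using trig_closureD(2)[OF p] unfolding bounded_iff by (metis rangeI)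
  obtain C where C: "\<And>\<xi>. cmod (q \<xi>) \<le> C"
    using trig_closureD(2)[OF q] unfolding bounded_iff by (metis rangeI)
  have "B \<ge> 0" using order_trans[OF norm_ge_zero B] .
  have "cmod (p \<xi> * q \<xi>) \<le> B * C" for \<xi>
    unfolding norm_mult using B C \<open>B \<ge> 0\<close> by (intro mult_mono) auto
  then show bdd: "bounded (range (\<lambda>\<xi>. p \<xi> * q \<xi>))" by (auto simp: bounded_iff)
  fix e :: real assume e: "e > 0"
  obtain L where L: "\<And>M. M \<in> Ms \<Longrightarrow>
      (\<integral>\<xi>. (cmod (q \<xi> - lincomb character L \<xi>))\<^sup>2 \<partial>M) < e / (B\<^sup>2 + 1)"
    using trig_closureD(3)[OF q, of "e / (B\<^sup>2 + 1)"] e by (auto simp: add_nonneg_pos)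
  have pL: "(\<lambda>\<xi>. p \<xi> * lincomb character L \<xi>) \<in> trig_closure Ms"
    by (rule trig_closure_mult_trig[OF p])
  have "(\<integral>\<xi>. (cmod (p \<xi> * q \<xi> - p \<xi> * lincomb character L \<xi>))\<^sup>2 \<partial>M) < e" if M: "M \<in> Ms" for M
  proof -
    have "(cmod (p \<xi> * q \<xi> - p \<xi> * lincomb character L \<xi>))\<^sup>2
        \<le> B\<^sup>2 * (cmod (q \<xi> - lincomb character L \<xi>))\<^sup>2" for \<xi>
      unfolding right_diff_distrib[symmetric] norm_mult power_mult_distrib
      using B[of \<xi>] by (intro mult_right_mono power_mono) auto
    then have "(\<integral>\<xi>. (cmod (p \<xi> * q \<xi> - p \<xi> * lincomb character L \<xi>))\<^sup>2 \<partial>M)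
        \<le> (\<integral>\<xi>. B\<^sup>2 * (cmod (q \<xi> - lincomb character L \<xi>))\<^sup>2 \<partial>M)"
      by (intro integral_mono integrable_mult_right integrable_sq_diff[OF M] trig_closureD(1)[OF pL]
          bdd trig_closureD(2)[OF q] trig_closureD(2)[OF pL] trig_bounded_range) measurable
    also have "\<dots> = B\<^sup>2 * (\<integral>\<xi>. (cmod (q \<xi> - lincomb character L \<xi>))\<^sup>2 \<partial>M)" by simp
    also have "\<dots> \<le> B\<^sup>2 * (e / (B\<^sup>2 + 1))"
      using L[OF M] by (intro mult_left_mono) auto
    also have "\<dots> < e"
      using e by (simp add: divide_simps add_nonneg_pos)
    finally show ?thesis .
  qed
  then show "\<exists>r\<in>trig_closure Ms. \<forall>M\<in>Ms. (\<integral>\<xi>. (cmod (p \<xi> * q \<xi> - r \<xi>))\<^sup>2 \<partial>M) < e"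
    using pL by (intro bexI[of _ "\<lambda>\<xi>. p \<xi> * lincomb character L \<xi>"]) auto
qed

lemma trig_closure_power: "p \<in> trig_closure Ms \<Longrightarrow> (\<lambda>\<xi>. p \<xi> ^ n) \<in> trig_closure Ms"
  by (induction n) (auto intro: trig_closure_mult trig_closure_const)

lemma trig_closure_sum:
  "(\<And>i. i \<in> I \<Longrightarrow> p i \<in> trig_closure Ms) \<Longrightarrow> (\<lambda>\<xi>. \<Sum>i\<in>I. p i \<xi>) \<in> trig_closure Ms"
  by (induction I rule: infinite_finite_induct) (auto intro: trig_closure_add trig_closure_const)

end

section \<open>Density of trigonometric polynomials\<close>

context finite_borel_measures begin

text \<open>By the Weierstrass theorem, applied to \<open>s \<mapsto> max 0 (2 s - 1)\<close> at \<open>s = (1 + u) / 2\<close>, the positive part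
\<open>max 0 u\<close> is a uniform limit of polynomials in \<open>u\<close>. The powers of \<open>1 - max 0 u\<close> then decrease to the
indicator function.\<close>

lemma trig_closure_indicator_nonpos:
  fixes u :: "'a \<Rightarrow> real"
  assumes u: "(\<lambda>\<xi>. of_real (u \<xi>)) \<in> trig_closure Ms" and u1: "\<And>\<xi>. \<bar>u \<xi>\<bar> \<le> 1"
  shows "indicator {\<xi>. u \<xi> \<le> 0} \<in> trig_closure Ms"
proof -
  define t where "t \<xi> = (1 + u \<xi>) / 2" for \<xi>
  have t01: "t \<xi> \<in> {0..1}" for \<xi> using u1[of \<xi>] by (auto simp: t_def)
  have t: "(\<lambda>\<xi>. of_real (t \<xi>)) \<in> trig_closure Ms"
    using trig_closure_scale[OF trig_closure_add[OF trig_closure_const[of 1] u], of "1/2"]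
    by (simp add: t_def)
  define \<phi> where "\<phi> s = max 0 (2 * s - 1)" for s :: real
  have \<phi>t: "\<phi> (t \<xi>) = max 0 (u \<xi>)" for \<xi> by (simp add: \<phi>_def t_def field_simps)
  have cont: "continuous_on {0..1} \<phi>" unfolding \<phi>_def by (intro continuous_intros)
  have "\<exists>N. \<forall>x\<in>{0..1}. \<bar>\<phi> x - (\<Sum>k\<le>N. \<phi> (k/N) * Bernstein N k x)\<bar> < inverse (real (Suc n))" for n
    using Bernstein_Weierstrass[OF cont, of "inverse (real (Suc n))"] by fastforce
  then obtain N where N: "\<And>n x. x \<in> {0..1} \<Longrightarrow>
      \<bar>\<phi> x - (\<Sum>k\<le>N n. \<phi> (k / N n) * Bernstein (N n) k x)\<bar> < inverse (real (Suc n))" by metis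
  define b where "b n \<xi> = (\<Sum>k\<le>N n. \<phi> (k / N n) * Bernstein (N n) k (t \<xi>))" for n \<xi>
  have b: "\<bar>max 0 (u \<xi>) - b n \<xi>\<bar> < inverse (real (Suc n))" for n \<xi>
    using N[OF t01[of \<xi>], of n] by (simp add: b_def \<phi>t)
  have v: "(\<lambda>\<xi>. of_real (max 0 (u \<xi>))) \<in> trig_closure Ms"
  proof (rule trig_closure_tendsto)
    show "(\<lambda>\<xi>. of_real (b n \<xi>)) \<in> trig_closure Ms" for n
    proof -
      have "(\<lambda>\<xi>. \<Sum>k\<le>N n. of_real (\<phi> (k / N n) * (N n choose k))
          * (of_real (t \<xi>) ^ k * (1 - of_real (t \<xi>)) ^ (N n - k))) \<in> trig_closure Ms"
        by (intro trig_closure_sum trig_closure_scale trig_closure_mult trig_closure_power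
            trig_closure_diff trig_closure_const t)
      then show ?thesis by (simp add: b_def Bernstein_def mult_ac)
    qed
    show "cmod (of_real (b n \<xi>)) \<le> 2" for n \<xi>
    proof -
      have "inverse (real (Suc n)) \<le> 1" by (simp add: field_simps)
      then show ?thesis using b[of \<xi> n] u1[of \<xi>] unfolding norm_of_real by linarith
    qed
    have "(\<lambda>n. max 0 (u \<xi>) - b n \<xi>) \<longlonglongrightarrow> 0" for \<xi>
      by (rule Lim_null_comparison[OF _ LIMSEQ_inverse_real_of_nat])
        (use b[of \<xi>] in \<open>auto intro!: always_eventually less_imp_le\<close>)
    then have "(\<lambda>n. max 0 (u \<xi>) - (max 0 (u \<xi>) - b n \<xi>)) \<longlonglongrightarrow> max 0 (u \<xi>) - 0" for \<xi>
      by (intro tendsto_diff tendsto_const)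
    then show "(\<lambda>n. complex_of_real (b n \<xi>)) \<longlonglongrightarrow> of_real (max 0 (u \<xi>))" for \<xi>
      by (intro tendsto_of_real) simp
  qed
  show ?thesis
  proof (rule trig_closure_tendsto)
    show "(\<lambda>\<xi>. (1 - of_real (max 0 (u \<xi>))) ^ n) \<in> trig_closure Ms" for n
      by (intro trig_closure_power trig_closure_diff trig_closure_const v)
    show "cmod ((1 - of_real (max 0 (u \<xi>))) ^ n) \<le> 1" for n \<xi>
    proof -
      have "1 - complex_of_real (max 0 (u \<xi>)) = of_real (1 - max 0 (u \<xi>))" by simp
      then show ?thesis using u1[of \<xi>] by (simp add: norm_power power_le_one del: of_real_diff)
    qed
    show "(\<lambda>n. (1 - complex_of_real (max 0 (u \<xi>))) ^ n) \<longlonglongrightarrow> indicator {\<xi>. u \<xi> \<le> 0} \<xi>" for \<xi>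
    proof (cases "u \<xi> \<le> 0")
      case False
      have "1 - complex_of_real (max 0 (u \<xi>)) = of_real (1 - max 0 (u \<xi>))" by simp
      then have "cmod (1 - complex_of_real (max 0 (u \<xi>))) < 1"
        using False u1[of \<xi>] by (simp only: norm_of_real)
      then show ?thesis using False by (auto intro!: LIMSEQ_power_zero)
    qed simp
  qed
qed

lemma trig_closure_sin:
  assumes "m > 0"
  shows "(\<lambda>\<xi>. of_real (sin ((\<xi> \<bullet> i - a) / m))) \<in> trig_closure Ms"
proof -
  let ?L = "[(cis (- a / m) / (2 * \<i>), - (1 / (2 * pi * m)) *\<^sub>R i),
      (- cis (a / m) / (2 * \<i>), (1 / (2 * pi * m)) *\<^sub>R i)]"
  have "lincomb character ?L \<xi> = of_real (sin ((\<xi> \<bullet> i - a) / m))" for \<xi>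
  proof -
    have c: "character (- (1 / (2 * pi * m)) *\<^sub>R i) \<xi> = cis (\<xi> \<bullet> i / m)"
      "character ((1 / (2 * pi * m)) *\<^sub>R i) \<xi> = cis (- (\<xi> \<bullet> i / m))"
      using assms unfolding character_def by simp_all
    have "lincomb character ?L \<xi> = (cis (- a / m) * cis (\<xi> \<bullet> i / m) - cis (a / m) * cis (- (\<xi> \<bullet> i / m))) / (2 * \<i>)"
      unfolding lincomb_Cons lincomb_Nil c by (simp add: field_simps)
    also have "\<dots> = (cis ((\<xi> \<bullet> i - a) / m) - cis (- ((\<xi> \<bullet> i - a) / m))) / (2 * \<i>)"
      by (simp add: cis_mult diff_divide_distrib)
    also have "\<dots> = of_real (sin ((\<xi> \<bullet> i - a) / m))"
      by (simp add: complex_eq_iff Re_divide Im_divide)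
    finally show ?thesis .
  qed
  then have "lincomb character ?L = (\<lambda>\<xi>. of_real (sin ((\<xi> \<bullet> i - a) / m)))" by blast
  then show ?thesis using trig_closure_trig[of ?L] by simp
qed

text \<open>Linear functions are not bounded, but they are rescaled limits of sines: for large \<open>m\<close> the sign of
\<open>sin ((\<xi> \<bullet> i - a) / m)\<close> is that of \<open>\<xi> \<bullet> i - a\<close>.\<close>

lemma trig_closure_halfspace: "indicator {\<xi>. \<xi> \<bullet> i \<le> a} \<in> trig_closure Ms"
proof (rule trig_closure_tendsto)
  show "indicator {\<xi>. sin ((\<xi> \<bullet> i - a) / real (Suc n)) \<le> 0} \<in> trig_closure Ms" for n
    by (intro trig_closure_indicator_nonpos trig_closure_sin) auto
  show "cmod (indicator {\<xi>. sin ((\<xi> \<bullet> i - a) / real (Suc n)) \<le> 0} \<xi>) \<le> 1" for n \<xi>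
    by (simp add: indicator_def)
  show "(\<lambda>n. indicator {\<xi>. sin ((\<xi> \<bullet> i - a) / real (Suc n)) \<le> 0} \<xi> :: complex)
      \<longlonglongrightarrow> indicator {\<xi>. \<xi> \<bullet> i \<le> a} \<xi>" for \<xi>
  proof (rule tendsto_eventually)
    define d where "d = \<xi> \<bullet> i - a"
    obtain N :: nat where N: "\<bar>d\<bar> < N" using reals_Archimedean2 by blast
    have "sin (d / real (Suc n)) \<le> 0 \<longleftrightarrow> d \<le> 0" if n: "n \<ge> N" for n
    proof -
      have "\<bar>d\<bar> < real (Suc n)" using N n by linarith
      then have "\<bar>d / real (Suc n)\<bar> < 1"
        unfolding abs_divide by (simp del: of_nat_Suc)
      then have d: "\<bar>d / real (Suc n)\<bar> < pi" using pi_gt3 by linarith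
      show ?thesis
      proof (cases "d \<le> 0")
        case True
        then have "sin (- (d / real (Suc n))) \<ge> 0"
          using d by (intro sin_ge_zero) (auto simp: divide_nonpos_pos)
        then show ?thesis using True by simp
      next
        case False
        then have "sin (d / real (Suc n)) > 0"
          using d by (intro sin_gt_zero) auto
        then show ?thesis using False by simp
      qed
    qed
    then show "\<forall>\<^sub>F n in sequentially. indicator {\<xi>. sin ((\<xi> \<bullet> i - a) / real (Suc n)) \<le> 0} \<xi>
        = (indicator {\<xi>. \<xi> \<bullet> i \<le> a} \<xi> :: complex)"
      by (auto simp: d_def eventually_sequentially indicator_def intro!: exI[of _ N])
  qed
qed

text \<open>The sets with indicator function in the class form a \<open>\<sigma>\<close>-algebra, and half-spaces generate the Borel
sets.\<close>

lemma trig_closure_indicator: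
  assumes "S \<in> sets borel"
  shows "indicator S \<in> trig_closure Ms"
proof -
  have "S \<in> sigma_sets UNIV ((\<lambda>(a, i). {x::'a. x \<bullet> i \<le> a}) ` (UNIV \<times> Basis))"
    using assms unfolding borel_eq_halfspace_le by (simp add: sets_measure_of)
  then show ?thesis
  proof (induction rule: sigma_sets.induct)
    case (Basic S)
    then show ?case using trig_closure_halfspace by auto
  next
    case Empty
    show ?case using trig_closure_const[of 0] by simp
  next
    case (Compl S)
    have "(indicator (UNIV - S) :: 'a \<Rightarrow> complex) = (\<lambda>\<xi>. 1 - indicator S \<xi>)"
      by (auto simp: indicator_def)
    then show ?case using trig_closure_diff[OF trig_closure_const[of 1] Compl.IH] by simp
  next
    case (Union A)
    have fin: "indicator (\<Union>i<n. A i) \<in> trig_closure Ms" for n :: nat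
    proof (induction n)
      case 0
      show ?case using trig_closure_const[of 0] by simp
    next
      case (Suc n)
      have "(indicator (\<Union>i<Suc n. A i) :: 'a \<Rightarrow> complex)
          = (\<lambda>\<xi>. 1 - (1 - indicator (\<Union>i<n. A i) \<xi>) * (1 - indicator (A n) \<xi>))"
        by (rule ext) (auto simp: indicator_def less_Suc_eq)
      moreover have "(\<lambda>\<xi>. 1 - (1 - indicator (\<Union>i<n. A i) \<xi>) * (1 - indicator (A n) \<xi>)) \<in> trig_closure Ms"
        by (intro trig_closure_diff trig_closure_mult trig_closure_const Suc Union.IH)
      ultimately show ?case by simp
    qed
    show ?case
    proof (rule trig_closure_tendsto[OF fin, where B = 1])
      show "cmod (indicator (\<Union>i<n. A i) \<xi>) \<le> 1" for n \<xi> by (simp add: indicator_def)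
    qed (rule LIMSEQ_indicator_UN)
  qed
qed

end

text \<open>Approximate the indicator function of \<open>S\<close> by a trigonometric polynomial in \<open>L\<^sup>2\<close> of both measures, and
apply the hypothesis to the polynomial. Passing from the indicator to the polynomial and back costs a
factor 2 each time, whence the 4.\<close>

lemma measure_le_if_trig_le:
  fixes \<mu> \<nu> :: "'a::euclidean_space measure"
  assumes fin: "finite_measure \<mu>" "finite_measure \<nu>"
    and sets: "sets \<mu> = sets borel" "sets \<nu> = sets borel"
    and C: "C \<ge> 0"
    and le: "\<And>L. (\<integral>\<xi>. (cmod (lincomb character L \<xi>))\<^sup>2 \<partial>\<nu>) \<le> C * (\<integral>\<xi>. (cmod (lincomb character L \<xi>))\<^sup>2 \<partial>\<mu>)"
    and S: "S \<in> sets borel"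
  shows "measure \<nu> S \<le> 4 * C * measure \<mu> S"
proof -
  interpret finite_borel_measures "{\<mu>, \<nu>}"
  proof (rule finite_borel_measures.intro)
    show "finite_measure M" if "M \<in> {\<mu>, \<nu>}" for M using that fin by blast
    show "sets M = sets borel" if "M \<in> {\<mu>, \<nu>}" for M using that sets by blast
  qed simp
  let ?p = "indicator S :: 'a \<Rightarrow> complex"
  have p: "?p \<in> trig_closure {\<mu>, \<nu>}" by (rule trig_closure_indicator[OF S])
  have meas: "(\<integral>\<xi>. (cmod (?p \<xi> - 0))\<^sup>2 \<partial>M) = measure M S" if "M \<in> {\<mu>, \<nu>}" for M
  proof -
    have "(\<lambda>\<xi>. (cmod (?p \<xi> - 0))\<^sup>2) = (indicator S :: 'a \<Rightarrow> real)"
      by (auto simp: indicator_def)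
    moreover have "space M = UNIV" using that sets[THEN sets_eq_imp_space_eq] by auto
    ultimately show ?thesis by simp
  qed
  note zero = trig_closure_const[of 0]
  have "measure \<nu> S \<le> 4 * C * measure \<mu> S + e" if e: "e > 0" for e
  proof -
    define e' where "e' = e / (2 + 4 * C)"
    have "e' > 0" using e C by (simp add: e'_def)
    then obtain L where L: "\<And>M. M \<in> {\<mu>, \<nu>} \<Longrightarrow> (\<integral>\<xi>. (cmod (?p \<xi> - lincomb character L \<xi>))\<^sup>2 \<partial>M) < e'"
      using trig_closureD(3)[OF p] by blast
    have L': "(\<integral>\<xi>. (cmod (lincomb character L \<xi> - ?p \<xi>))\<^sup>2 \<partial>M) < e'" if "M \<in> {\<mu>, \<nu>}" for M
      using L[OF that] by (simp add: norm_minus_commute)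
    have "measure \<nu> S = (\<integral>\<xi>. (cmod (?p \<xi> - 0))\<^sup>2 \<partial>\<nu>)" by (simp only: meas insertI1 insertI2)
    also have "\<dots> \<le> 2 * (\<integral>\<xi>. (cmod (?p \<xi> - lincomb character L \<xi>))\<^sup>2 \<partial>\<nu>)
        + 2 * (\<integral>\<xi>. (cmod (lincomb character L \<xi> - 0))\<^sup>2 \<partial>\<nu>)"
      by (intro integral_sq_diff_le trig_closureD[OF p] trig_closureD[OF zero] measurable_trig trig_bounded_range) auto
    also have "\<dots> \<le> 2 * e' + 2 * (C * (\<integral>\<xi>. (cmod (lincomb character L \<xi> - 0))\<^sup>2 \<partial>\<mu>))"
      using L[of \<nu>] le[of L] by simp
    also have "(\<integral>\<xi>. (cmod (lincomb character L \<xi> - 0))\<^sup>2 \<partial>\<mu>)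
        \<le> 2 * (\<integral>\<xi>. (cmod (lincomb character L \<xi> - ?p \<xi>))\<^sup>2 \<partial>\<mu>) + 2 * (\<integral>\<xi>. (cmod (?p \<xi> - 0))\<^sup>2 \<partial>\<mu>)"
      by (intro integral_sq_diff_le trig_closureD[OF p] trig_closureD[OF zero] measurable_trig trig_bounded_range) auto
    also have "(\<integral>\<xi>. (cmod (?p \<xi> - 0))\<^sup>2 \<partial>\<mu>) = measure \<mu> S" by (simp only: meas insertI1)
    also have "(\<integral>\<xi>. (cmod (lincomb character L \<xi> - ?p \<xi>))\<^sup>2 \<partial>\<mu>) \<le> e'"
      using L'[of \<mu>] by simp
    finally have "measure \<nu> S \<le> 2 * e' + 2 * (C * (2 * e' + 2 * measure \<mu> S))"
      using C by (simp add: mult_left_mono)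
    also have "\<dots> = (2 + 4 * C) * e' + 4 * C * measure \<mu> S" by (simp add: algebra_simps)
    also have "(2 + 4 * C) * e' = e" using C by (simp add: e'_def)
    finally show ?thesis by simp
  qed
  then show ?thesis by (rule field_le_epsilon)
qed

section \<open>Lebesgue measure under linear maps\<close>

lemma borel_measurable_linear:
  fixes B :: "'a::euclidean_space \<Rightarrow> 'b::euclidean_space"
  shows "linear B \<Longrightarrow> B \<in> borel_measurable borel"
  by (intro borel_measurable_continuous_onI linear_continuous_on) (simp add: linear_conv_bounded_linear)

lemma nn_integral_lborel_translate:
  fixes f :: "'a::euclidean_space \<Rightarrow> ennreal"
  assumes [measurable]: "f \<in> borel_measurable borel"
  shows "(\<integral>\<^sup>+x. f (c + x) \<partial>lborel) = (\<integral>\<^sup>+x. f x \<partial>lborel)"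
proof -
  have "(\<integral>\<^sup>+x. f x \<partial>distr lborel borel ((+) c)) = (\<integral>\<^sup>+x. f (c + x) \<partial>lborel)"
    by (intro nn_integral_distr) auto
  then show ?thesis by (simp add: lborel_distr_plus)
qed

lemma nn_integral_lborel_reflect:
  fixes f :: "'a::euclidean_space \<Rightarrow> ennreal"
  assumes [measurable]: "f \<in> borel_measurable borel"
  shows "(\<integral>\<^sup>+x. f (c - x) \<partial>lborel) = (\<integral>\<^sup>+x. f x \<partial>lborel)"
proof -
  have "lborel = distr lborel borel (\<lambda>x. c + (-1) *\<^sub>R x :: 'a)"
    using lborel_affine[of "-1" c] by (simp add: density_1)
  then have "(\<integral>\<^sup>+x. f x \<partial>lborel) = (\<integral>\<^sup>+x. f x \<partial>distr lborel borel (\<lambda>x. c + (-1) *\<^sub>R x))"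
    by simp
  also have "\<dots> = (\<integral>\<^sup>+x. f (c - x) \<partial>lborel)"
    by (subst nn_integral_distr) auto
  finally show ?thesis by simp
qed

text \<open>The proof of uniqueness of Haar measure, for the translation-invariant measure
\<open>S \<mapsto> emeasure lborel (B -` S)\<close>. Both sides are the same double integral of
\<open>indicator S (B x) * indicator T (B x + y)\<close>: integrate over \<open>y\<close> first, or shift \<open>x\<close> by \<open>- C y\<close> and then
integrate over \<open>y\<close>.\<close>

lemma emeasure_lborel_linear_vimage_cross:
  fixes B C :: "'a::euclidean_space \<Rightarrow> 'a"
  assumes B: "linear B" and C: "linear C" and BC: "\<And>x. B (C x) = x"
    and S: "S \<in> sets borel" and T: "T \<in> sets borel"
  shows "emeasure lborel (B -` S) * emeasure lborel T = emeasure lborel S * emeasure lborel (B -` T)"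
proof -
  have [measurable]: "B \<in> borel_measurable borel" "C \<in> borel_measurable borel"
    using B C by (simp_all add: borel_measurable_linear)
  note [measurable] = S T
  have vimage [measurable]: "B -` X \<in> sets borel" if "X \<in> sets borel" for X
    using measurable_sets[of B borel borel X] that by simp
  have T_translate: "(\<integral>\<^sup>+y. indicator T (z + y) \<partial>lborel) = emeasure lborel T" for z
    by (subst nn_integral_lborel_translate) auto
  have S_reflect: "(\<integral>\<^sup>+y. indicator S (z - y) \<partial>lborel) = emeasure lborel S" for z
    by (subst nn_integral_lborel_reflect) auto
  have vimage_int: "(\<integral>\<^sup>+x. indicator X (B x) \<partial>lborel) = emeasure lborel (B -` X)" if "X \<in> sets borel" for X
    using nn_integral_indicator[of "B -` X" lborel] vimage[OF that] by (simp add: indicator_vimage)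
  have "emeasure lborel (B -` S) * emeasure lborel T
      = (\<integral>\<^sup>+x. \<integral>\<^sup>+y. indicator S (B x) * indicator T (B x + y) \<partial>lborel \<partial>lborel)"
    by (simp add: nn_integral_cmult nn_integral_multc T_translate vimage_int S)
  also have "\<dots> = (\<integral>\<^sup>+y. \<integral>\<^sup>+x. indicator S (B x) * indicator T (B x + y) \<partial>lborel \<partial>lborel)"
    by (intro lborel_pair.Fubini'[symmetric]) measurable
  also have "\<dots> = (\<integral>\<^sup>+y. \<integral>\<^sup>+x. indicator S (B x - y) * indicator T (B x) \<partial>lborel \<partial>lborel)"
  proof (rule nn_integral_cong)
    fix y
    have shift: "B (- C y + x) = B x - y" for x
      by (simp add: linear_add[OF B] linear_diff[OF B] linear_neg[OF B] BC)
    have "(\<integral>\<^sup>+x. indicator S (B x) * indicator T (B x + y) \<partial>lborel)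
      = (\<integral>\<^sup>+x. indicator S (B (- C y + x)) * (indicator T (B (- C y + x) + y) :: ennreal) \<partial>lborel)"
      by (rule nn_integral_lborel_translate[symmetric]) measurable
    then show "(\<integral>\<^sup>+x. indicator S (B x) * indicator T (B x + y) \<partial>lborel)
      = (\<integral>\<^sup>+x. indicator S (B x - y) * (indicator T (B x) :: ennreal) \<partial>lborel)"
      unfolding shift by simp
  qed
  also have "\<dots> = (\<integral>\<^sup>+x. \<integral>\<^sup>+y. indicator S (B x - y) * indicator T (B x) \<partial>lborel \<partial>lborel)"
    by (intro lborel_pair.Fubini') measurable
  also have "\<dots> = emeasure lborel S * emeasure lborel (B -` T)"
    by (simp add: nn_integral_cmult nn_integral_multc S_reflect vimage_int T)
  finally show ?thesis .
qed

text \<open>The factor \<open>c = 1 / |det B|\<close> appears as the measure of the preimage of the unit box, which is the set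
\<open>T\<close> in the identity above.\<close>

lemma lborel_distr_linear:
  fixes B :: "'a::euclidean_space \<Rightarrow> 'a"
  assumes B: "linear B" and inj: "inj B"
  obtains c :: real where "c > 0" "distr lborel borel B = density lborel (\<lambda>_. ennreal c)"
proof -
  obtain C where C: "linear C" "\<And>x. C (B x) = x" "\<And>x. B (C x) = x"
    using linear_injective_isomorphism[OF B inj] by blast
  have [measurable]: "B \<in> borel_measurable borel" "C \<in> borel_measurable borel"
    using B C(1) by (simp_all add: borel_measurable_linear)
  let ?T = "box 0 One :: 'a set"
  have T: "emeasure lborel ?T = 1" by (simp add: emeasure_lborel_box)
  have CT: "C -` ?T \<in> sets borel"
    using measurable_sets[of C borel borel ?T] by simp
  have scale: "emeasure lborel (B -` S) = emeasure lborel S * emeasure lborel (B -` ?T)" if "S \<in> sets borel" for S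
    using emeasure_lborel_linear_vimage_cross[OF B C(1,3) that, of ?T] T by simp
  \<comment> \<open>Taking \<open>S = C -` ?T\<close> shows that the factor is neither 0 nor infinite.\<close>
  have "B -` (C -` ?T) = ?T" using C by auto
  then have one: "1 = emeasure lborel (C -` ?T) * emeasure lborel (B -` ?T)"
    using scale[OF CT] T by simp
  have "emeasure lborel (B -` ?T) \<noteq> 0" using one by auto
  moreover have "emeasure lborel (B -` ?T) \<noteq> \<infinity>"
    using one by (auto simp: ennreal_mult_top split: if_splits)
  ultimately obtain c where c: "c > 0" "emeasure lborel (B -` ?T) = ennreal c"
    by (cases "emeasure lborel (B -` ?T)") (auto simp: top_unique less_le)
  have "distr lborel borel B = density lborel (\<lambda>_. ennreal c)"
    by (rule measure_eqI) (auto simp: emeasure_distr emeasure_density_const scale c(2) mult.commute)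
  then show thesis using that c(1) by blast
qed

section \<open>Weights and quadratic forms\<close>

lemma integrable_bounded_mult:
  fixes p :: "'a::euclidean_space \<Rightarrow> 'b::{second_countable_topology, banach}"
  assumes w: "integrable lborel w" and p: "p \<in> borel_measurable borel" "bounded (range p)"
  shows "integrable lborel (\<lambda>\<xi>. w \<xi> *\<^sub>R p \<xi>)"
proof -
  obtain B where B: "\<And>\<xi>. norm (p \<xi>) \<le> B"
    using p(2) unfolding bounded_iff by (metis rangeI)
  have [measurable]: "w \<in> borel_measurable borel" using borel_measurable_integrable[OF w] by simp
  note [measurable] = p(1)
  show ?thesis
  proof (rule Bochner_Integration.integrable_bound)
    show "integrable lborel (\<lambda>\<xi>. B * w \<xi>)" using w by simp
    have "norm (w \<xi> *\<^sub>R p \<xi>) \<le> norm (B * w \<xi>)" for \<xi>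
    proof -
      have "norm (p \<xi>) \<le> \<bar>B\<bar>" using B[of \<xi>] by linarith
      then show ?thesis
        using mult_right_mono[of "norm (p \<xi>)" "\<bar>B\<bar>" "\<bar>w \<xi>\<bar>"] by (simp add: abs_mult mult.commute)
    qed
    then show "AE \<xi> in lborel. norm (w \<xi> *\<^sub>R p \<xi>) \<le> norm (B * w \<xi>)" by simp
  qed measurable
qed

text \<open>The change of variables in the three forms used below; the last one says that the preimage of a null
set is null, for predicates that need not be measurable.\<close>

lemma lborel_linear_change:
  fixes B :: "'a::euclidean_space \<Rightarrow> 'a"
  assumes B: "linear B" "inj B"
  obtains c :: real where "c > 0"
    "\<And>g :: 'a \<Rightarrow> real. integrable lborel g \<Longrightarrow> integrable lborel (\<lambda>x. g (B x))"
    "\<And>g :: 'a \<Rightarrow> real. integrable lborel g \<Longrightarrow> (\<integral>x. g (B x) \<partial>lborel) = c * (\<integral>x. g x \<partial>lborel)"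
    "\<And>P. (AE x in lborel. P x) \<Longrightarrow> (AE x in lborel. P (B x))"
proof -
  obtain c where c: "c > 0" "distr lborel borel B = density lborel (\<lambda>_. ennreal c)"
    by (rule lborel_distr_linear[OF B])
  have [measurable]: "B \<in> borel_measurable borel"
    by (rule borel_measurable_linear[OF B(1)])
  have "integrable lborel (\<lambda>x. g (B x))" if g: "integrable lborel g" for g :: "'a \<Rightarrow> real"
  proof -
    have [measurable]: "g \<in> borel_measurable borel" using borel_measurable_integrable[OF g] by simp
    have "integrable (distr lborel borel B) g"
      unfolding c(2) using g c(1) by (subst integrable_density) auto
    then show ?thesis by (subst (asm) integrable_distr_eq) auto
  qed
  moreover have "(\<integral>x. g (B x) \<partial>lborel) = c * (\<integral>x. g x \<partial>lborel)" if g: "integrable lborel g" for g :: "'a \<Rightarrow> real"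
  proof -
    have [measurable]: "g \<in> borel_measurable borel" using borel_measurable_integrable[OF g] by simp
    have "(\<integral>x. g (B x) \<partial>lborel) = (\<integral>x. g x \<partial>distr lborel borel B)"
      by (subst integral_distr) auto
    also have "\<dots> = c * (\<integral>x. g x \<partial>lborel)"
      unfolding c(2) using c(1) by (subst integral_density) auto
    finally show ?thesis .
  qed
  moreover have "AE x in lborel. P (B x)" if P: "AE x in lborel. P x" for P
  proof (rule AE_distrD[of B lborel borel P])
    show "AE x in distr lborel borel B. P x"
      unfolding c(2) using P by (subst AE_density) (auto elim: AE_mp)
  qed simp
  ultimately show thesis using that c(1) by blast
qed

lemma bounded_norm_sq_trig: "bounded (range (\<lambda>\<xi>. (cmod (lincomb character L \<xi>))\<^sup>2))"
proof -
  obtain B where "\<And>\<xi>. cmod (lincomb character L \<xi>) \<le> B" using trig_bounded by blast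
  then show ?thesis
    by (auto simp: bounded_iff intro!: exI[of _ "B\<^sup>2"] power_mono)
qed

locale borel_weight =
  fixes w :: "'a::euclidean_space \<Rightarrow> real"
  assumes integrable_w: "integrable lborel w"
    and w_nonneg: "\<And>\<xi>. 0 \<le> w \<xi>"
begin

lemma measurable_w [measurable]: "w \<in> borel_measurable borel"
  using borel_measurable_integrable[OF integrable_w] by simp

lemma quadratic_le_if_weight_le:
  assumes B: "linear B" "inj B" and l: "l > 0" and le: "AE \<xi> in lborel. l * w \<xi> \<le> w (B \<xi>)"
  shows "\<exists>C\<ge>0. \<forall>L. (\<integral>\<xi>. w \<xi> * (cmod (lincomb character L (B \<xi>)))\<^sup>2 \<partial>lborel)
    \<le> C * (\<integral>\<xi>. w \<xi> * (cmod (lincomb character L \<xi>))\<^sup>2 \<partial>lborel)"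
proof -
  obtain c where c: "c > 0"
    and int: "\<And>g :: 'a \<Rightarrow> real. integrable lborel g \<Longrightarrow> integrable lborel (\<lambda>x. g (B x))"
    and eq: "\<And>g :: 'a \<Rightarrow> real. integrable lborel g \<Longrightarrow> (\<integral>x. g (B x) \<partial>lborel) = c * (\<integral>x. g x \<partial>lborel)"
    by (rule lborel_linear_change[OF B]) blast
  have [measurable]: "B \<in> borel_measurable borel"
    by (rule borel_measurable_linear[OF B(1)])
  have "(\<integral>\<xi>. w \<xi> * (cmod (lincomb character L (B \<xi>)))\<^sup>2 \<partial>lborel)
    \<le> (c / l) * (\<integral>\<xi>. w \<xi> * (cmod (lincomb character L \<xi>))\<^sup>2 \<partial>lborel)" for L
  proof -
    define g where "g \<xi> = w \<xi> * (cmod (lincomb character L \<xi>))\<^sup>2" for \<xi>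
    have g: "integrable lborel g"
      unfolding g_def using integrable_bounded_mult[OF integrable_w _ bounded_norm_sq_trig, of L] by simp
    have "bounded (range (\<lambda>\<xi>. (cmod (lincomb character L (B \<xi>)))\<^sup>2))"
      by (rule bounded_subset[OF bounded_norm_sq_trig]) auto
    then have "integrable lborel (\<lambda>\<xi>. w \<xi> * (cmod (lincomb character L (B \<xi>)))\<^sup>2)"
      using integrable_bounded_mult[OF integrable_w, of "\<lambda>\<xi>. (cmod (lincomb character L (B \<xi>)))\<^sup>2"] by simp
    then have "(\<integral>\<xi>. w \<xi> * (cmod (lincomb character L (B \<xi>)))\<^sup>2 \<partial>lborel) \<le> (\<integral>\<xi>. (1 / l) * g (B \<xi>) \<partial>lborel)"
    proof (rule integral_mono_AE)
      show "AE \<xi> in lborel. w \<xi> * (cmod (lincomb character L (B \<xi>)))\<^sup>2 \<le> (1 / l) * g (B \<xi>)"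
        using le
      proof eventually_elim
        case (elim \<xi>)
        then have "w \<xi> \<le> (1 / l) * w (B \<xi>)" using l by (simp add: field_simps)
        then have "w \<xi> * (cmod (lincomb character L (B \<xi>)))\<^sup>2
            \<le> (1 / l) * w (B \<xi>) * (cmod (lincomb character L (B \<xi>)))\<^sup>2"
          by (intro mult_right_mono) auto
        then show ?case by (simp add: g_def)
      qed
    qed (use int[OF g] in simp)
    also have "\<dots> = (c / l) * (\<integral>\<xi>. g \<xi> \<partial>lborel)" using eq[OF g] by simp
    finally show ?thesis by (simp only: g_def)
  qed
  then show ?thesis using c l by (intro exI[of _ "c / l"]) auto
qed

text \<open>By Bochner's theorem this is the measure that belongs to the positive definite function \<open>x \<mapsto> k x 0\<close>.\<close>

definition spectral_measure :: "'a measure" where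
  "spectral_measure = density lborel (\<lambda>\<xi>. ennreal (w \<xi>))"

lemma sets_spectral_measure [simp, measurable_cong]: "sets spectral_measure = sets borel"
  by (simp add: spectral_measure_def)

lemma space_spectral_measure [simp]: "space spectral_measure = UNIV"
  by (simp add: spectral_measure_def)

lemma emeasure_spectral_measure:
  assumes [measurable]: "S \<in> sets borel"
  shows "emeasure spectral_measure S = ennreal (\<integral>\<xi>. indicator S \<xi> * w \<xi> \<partial>lborel)"
proof -
  have "emeasure spectral_measure S = (\<integral>\<^sup>+\<xi>. ennreal (indicator S \<xi> * w \<xi>) \<partial>lborel)"
    unfolding spectral_measure_def
    by (subst emeasure_density) (auto simp: indicator_def intro!: nn_integral_cong)
  also have "\<dots> = ennreal (\<integral>\<xi>. indicator S \<xi> * w \<xi> \<partial>lborel)"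
    using integrable_w w_nonneg
    by (intro nn_integral_eq_integral integrable_real_mult_indicator)
      (auto intro!: AE_I2 integrable_mult_indicator[of S lborel w, simplified])
  finally show ?thesis .
qed

lemma measure_spectral_measure:
  assumes "S \<in> sets borel"
  shows "measure spectral_measure S = (\<integral>\<xi>. indicator S \<xi> * w \<xi> \<partial>lborel)"
  unfolding measure_def emeasure_spectral_measure[OF assms]
  by (rule enn2real_ennreal) (auto intro!: integral_nonneg_AE simp: w_nonneg)

lemma finite_spectral_measure: "finite_measure spectral_measure"
  by (rule finite_measureI) (simp add: emeasure_spectral_measure)

text \<open>The hypothesis compares the spectral measure with its image under \<open>B\<close> on squared moduli of trigonometric
polynomials, hence on Borel sets. For singular \<open>B\<close> the image is concentrated on the null set
\<open>range B\<close> but has the same positive total mass. For invertible \<open>B\<close> both measures have densities, and the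
set where the desired inequality between them fails has measure 0.\<close>

lemma weight_le_if_quadratic_le:
  assumes B: "linear B" and C: "C \<ge> 0"
    and le: "\<And>L. (\<integral>\<xi>. w \<xi> * (cmod (lincomb character L (B \<xi>)))\<^sup>2 \<partial>lborel)
      \<le> C * (\<integral>\<xi>. w \<xi> * (cmod (lincomb character L \<xi>))\<^sup>2 \<partial>lborel)"
    and nonzero: "\<not> (AE \<xi> in lborel. w \<xi> = 0)"
  shows "inj B \<and> (\<exists>l>0. AE \<xi> in lborel. l * w \<xi> \<le> w (B \<xi>))"
proof -
  let ?\<mu> = spectral_measure
  define \<nu> where "\<nu> = distr ?\<mu> borel B"
  have [measurable]: "B \<in> borel_measurable borel"
    by (rule borel_measurable_linear[OF B(1)])
  have domination: "measure \<nu> S \<le> 4 * C * measure ?\<mu> S" if "S \<in> sets borel" for S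
  proof (rule measure_le_if_trig_le[OF finite_spectral_measure])
    interpret finite_measure ?\<mu> by (rule finite_spectral_measure)
    show "finite_measure \<nu>" unfolding \<nu>_def by (rule finite_measure_distr) simp
    have "(\<integral>\<xi>. (cmod (lincomb character L \<xi>))\<^sup>2 \<partial>\<nu>)
        = (\<integral>\<xi>. w \<xi> * (cmod (lincomb character L (B \<xi>)))\<^sup>2 \<partial>lborel)" for L
      unfolding \<nu>_def spectral_measure_def using w_nonneg
      by (subst integral_distr) (auto simp: integral_density)
    moreover have "(\<integral>\<xi>. (cmod (lincomb character L \<xi>))\<^sup>2 \<partial>?\<mu>)
        = (\<integral>\<xi>. w \<xi> * (cmod (lincomb character L \<xi>))\<^sup>2 \<partial>lborel)" for L
      unfolding spectral_measure_def using w_nonneg by (auto simp: integral_density)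
    ultimately show "(\<integral>\<xi>. (cmod (lincomb character L \<xi>))\<^sup>2 \<partial>\<nu>)
        \<le> C * (\<integral>\<xi>. (cmod (lincomb character L \<xi>))\<^sup>2 \<partial>?\<mu>)" for L
      using le[of L] by simp
  qed (use that C in \<open>auto simp: \<nu>_def\<close>)
  have \<nu>: "measure \<nu> S = measure ?\<mu> (B -` S)" if "S \<in> sets borel" for S
    using that by (simp add: \<nu>_def measure_distr)
  have inj: "inj B"
  proof (rule ccontr)
    assume "\<not> inj B"
    then have "negligible (range B)"
      using B negligible_linear_singular_image by blast
    moreover have "closed (range B)"
      using B by (intro closed_subspace linear_subspace_image) auto
    ultimately have "range B \<in> sets borel" "AE \<xi> in lborel. \<xi> \<notin> range B"
      using AE_not_in[of "range B" lborel] by (auto simp: negligible_iff_null_sets null_sets_completion_iff)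
    then have "measure ?\<mu> (range B) = 0"
      unfolding measure_spectral_measure[OF \<open>range B \<in> sets borel\<close>]
      by (intro integral_eq_zero_AE) auto
    moreover have "B -` range B = UNIV" by auto
    ultimately have "measure ?\<mu> UNIV \<le> 0"
      using domination[of "range B"] \<nu>[of "range B"] \<open>range B \<in> sets borel\<close> by simp
    then have "(\<integral>\<xi>. w \<xi> \<partial>lborel) = 0"
      using w_nonneg by (simp add: measure_spectral_measure antisym integral_nonneg_AE)
    then show False
      using nonzero integral_nonneg_eq_0_iff_AE[OF integrable_w] w_nonneg by simp
  qed
  obtain c where c: "c > 0"
    and int: "\<And>g :: 'a \<Rightarrow> real. integrable lborel g \<Longrightarrow> integrable lborel (\<lambda>x. g (B x))"
    and eq: "\<And>g :: 'a \<Rightarrow> real. integrable lborel g \<Longrightarrow> (\<integral>x. g (B x) \<partial>lborel) = c * (\<integral>x. g x \<partial>lborel)"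
    by (rule lborel_linear_change[OF B inj]) blast
  define K where "K = 4 * C / c"
  have K: "K \<ge> 0" using C c by (simp add: K_def)
  define S where "S = {\<xi>. K * w (B \<xi>) < w \<xi>}"
  have S [measurable]: "S \<in> sets borel" unfolding S_def by measurable
  obtain D where D: "linear D" "\<And>x. D (B x) = x" "\<And>x. B (D x) = x"
    using linear_injective_isomorphism[OF B inj] by blast
  have [measurable]: "D \<in> borel_measurable borel"
    using D(1) by (rule borel_measurable_linear)
  have DS: "D -` S \<in> sets borel"
    using measurable_sets[of D borel borel S] by simp
  have int_S: "integrable lborel (\<lambda>\<xi>. indicator X \<xi> * w \<xi>)" if "X \<in> sets borel" for X
    using integrable_mult_indicator[of X lborel w] that integrable_w by simp
  \<comment> \<open>The domination is applied to the image of \<open>S\<close> under \<open>B\<close>, written as a preimage under the inverse \<open>D\<close>.\<close>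
  have "measure ?\<mu> S = measure \<nu> (D -` S)"
    using D by (simp add: \<nu> DS vimage_comp o_def)
  also have "\<dots> \<le> 4 * C * measure ?\<mu> (D -` S)" by (rule domination[OF DS])
  also have "\<dots> = K * (c * (\<integral>\<xi>. indicator (D -` S) \<xi> * w \<xi> \<partial>lborel))"
    using c by (simp add: K_def measure_spectral_measure DS)
  also have "c * (\<integral>\<xi>. indicator (D -` S) \<xi> * w \<xi> \<partial>lborel) = (\<integral>\<xi>. indicator S \<xi> * w (B \<xi>) \<partial>lborel)"
    using eq[OF int_S[OF DS]] by (simp add: indicator_def D)
  finally have "(\<integral>\<xi>. indicator S \<xi> * w \<xi> \<partial>lborel) \<le> K * (\<integral>\<xi>. indicator S \<xi> * w (B \<xi>) \<partial>lborel)"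
    by (simp add: measure_spectral_measure S)
  moreover have int_SB: "integrable lborel (\<lambda>\<xi>. indicator S \<xi> * w (B \<xi>))"
    using int[OF int_S[OF DS]] by (simp add: indicator_def D)
  moreover have "(\<lambda>\<xi>. indicator S \<xi> * (w \<xi> - K * w (B \<xi>)))
      = (\<lambda>\<xi>. indicator S \<xi> * w \<xi> - K * (indicator S \<xi> * w (B \<xi>)))"
    by (auto simp: indicator_def)
  ultimately have nonpos: "(\<integral>\<xi>. indicator S \<xi> * (w \<xi> - K * w (B \<xi>)) \<partial>lborel) \<le> 0"
    and int_diff: "integrable lborel (\<lambda>\<xi>. indicator S \<xi> * (w \<xi> - K * w (B \<xi>)))"
    using int_S[OF S] by simp_all
  have nn: "AE \<xi> in lborel. 0 \<le> indicator S \<xi> * (w \<xi> - K * w (B \<xi>))"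
    by (auto simp: S_def indicator_def)
  have "AE \<xi> in lborel. indicator S \<xi> * (w \<xi> - K * w (B \<xi>)) = 0"
    using integral_nonneg_eq_0_iff_AE[OF int_diff nn] integral_nonneg_AE[OF nn] nonpos by simp
  \<comment> \<open>\<open>K\<close> may be 0, hence \<open>K + 1\<close>.\<close>
  then have "AE \<xi> in lborel. 1 / (K + 1) * w \<xi> \<le> w (B \<xi>)"
  proof eventually_elim
    case (elim \<xi>)
    then have "w \<xi> \<le> K * w (B \<xi>)" by (auto simp: S_def indicator_def split: if_splits)
    also have "\<dots> \<le> (K + 1) * w (B \<xi>)" using w_nonneg[of "B \<xi>"] by (simp add: distrib_right)
    finally show ?case using K by (simp add: field_simps)
  qed
  then show ?thesis using inj K by (intro conjI exI[of _ "1 / (K + 1)"]) auto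
qed

end

section \<open>Translation-invariant kernels\<close>

locale translation_kernel_rkhs = rkhs k H ip + borel_weight w
  for k :: "'a::euclidean_space \<Rightarrow> 'a \<Rightarrow> complex" and H ip and w :: "'a \<Rightarrow> real" +
  assumes kernel_eq: "\<And>x y. k x y = (\<integral>\<xi>. w \<xi> *\<^sub>R character (x - y) \<xi> \<partial>lborel)"
begin

lemma integrable_weighted_trig_product:
  "integrable lborel (\<lambda>\<xi>. w \<xi> *\<^sub>R (lincomb (\<lambda>x. character (\<phi> x)) K \<xi> * cnj (lincomb (\<lambda>x. character (\<phi> x)) L \<xi>)))"
proof (rule integrable_bounded_mult[OF integrable_w])
  have eq: "lincomb (\<lambda>x. character (\<phi> x)) L = lincomb character (map (\<lambda>(a, x). (a, \<phi> x)) L)" for L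
    by (induction L) auto
  obtain A B where "\<And>\<xi>. cmod (lincomb (\<lambda>x. character (\<phi> x)) K \<xi>) \<le> A"
      "\<And>\<xi>. cmod (lincomb (\<lambda>x. character (\<phi> x)) L \<xi>) \<le> B"
    unfolding eq using trig_bounded by metis
  then show "bounded (range (\<lambda>\<xi>. lincomb (\<lambda>x. character (\<phi> x)) K \<xi> * cnj (lincomb (\<lambda>x. character (\<phi> x)) L \<xi>)))"
    by (auto simp: bounded_iff norm_mult intro!: exI[of _ "A * B"] mult_mono
        intro: order_trans[OF norm_ge_zero])
  show "(\<lambda>\<xi>. lincomb (\<lambda>x. character (\<phi> x)) K \<xi> * cnj (lincomb (\<lambda>x. character (\<phi> x)) L \<xi>)) \<in> borel_measurable borel"
  proof -
    have [measurable]: "cnj \<in> borel_measurable borel"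
      by (intro borel_measurable_continuous_onI continuous_intros)
    show ?thesis unfolding eq by measurable
  qed
qed

lemma weighted_integral_linear:
  fixes p q :: "'a \<Rightarrow> complex"
  assumes p: "integrable lborel (\<lambda>\<xi>. w \<xi> *\<^sub>R p \<xi>)" and q: "integrable lborel (\<lambda>\<xi>. w \<xi> *\<^sub>R q \<xi>)"
  shows "(\<integral>\<xi>. w \<xi> *\<^sub>R (c * p \<xi> + q \<xi>) \<partial>lborel)
    = c * (\<integral>\<xi>. w \<xi> *\<^sub>R p \<xi> \<partial>lborel) + (\<integral>\<xi>. w \<xi> *\<^sub>R q \<xi> \<partial>lborel)"
proof -
  have "(\<integral>\<xi>. w \<xi> *\<^sub>R (c * p \<xi> + q \<xi>) \<partial>lborel) = (\<integral>\<xi>. c * (w \<xi> *\<^sub>R p \<xi>) + w \<xi> *\<^sub>R q \<xi> \<partial>lborel)"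
    by (simp add: algebra_simps)
  also have "\<dots> = (\<integral>\<xi>. c * (w \<xi> *\<^sub>R p \<xi>) \<partial>lborel) + (\<integral>\<xi>. w \<xi> *\<^sub>R q \<xi> \<partial>lborel)"
    by (intro Bochner_Integration.integral_add integrable_mult_right p q)
  also have "(\<integral>\<xi>. c * (w \<xi> *\<^sub>R p \<xi>) \<partial>lborel) = c * (\<integral>\<xi>. w \<xi> *\<^sub>R p \<xi> \<partial>lborel)"
    by (rule integral_mult_right_zero)
  finally show ?thesis .
qed

text \<open>The feature map \<open>k x \<mapsto> e\<^sub>x\<close> into \<open>L\<^sup>2\<close> of the spectral measure is isometric. The points are reparametrised
by \<open>\<phi>\<close> so that the statement covers kernel sums and their images \<open>k (f x)\<close> alike.\<close>

lemma ip_lincomb_eq_integral: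
  "ip (lincomb (\<lambda>x. k (\<phi> x)) K) (lincomb (\<lambda>x. k (\<phi> x)) L)
    = (\<integral>\<xi>. w \<xi> *\<^sub>R (lincomb (\<lambda>x. character (\<phi> x)) K \<xi> * cnj (lincomb (\<lambda>x. character (\<phi> x)) L \<xi>)) \<partial>lborel)"
proof (induction K)
  case Nil
  show ?case by (simp add: ip_zero_left lincomb_mem)
next
  case (Cons p K)
  obtain a x where p: "p = (a, x)" by (cases p)
  have int: "integrable lborel (\<lambda>\<xi>. w \<xi> *\<^sub>R (character (\<phi> x) \<xi> * cnj (lincomb (\<lambda>x. character (\<phi> x)) L \<xi>)))" for L x
    using integrable_weighted_trig_product[of \<phi> "[(1, x)]" L] by simp
  have "ip (k (\<phi> x)) (lincomb (\<lambda>x. k (\<phi> x)) L)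
      = (\<integral>\<xi>. w \<xi> *\<^sub>R (character (\<phi> x) \<xi> * cnj (lincomb (\<lambda>x. character (\<phi> x)) L \<xi>)) \<partial>lborel)" for L
  proof (induction L)
    case Nil
    show ?case by (simp add: ip_zero_right kernel_mem)
  next
    case (Cons q L)
    obtain b y where q: "q = (b, y)" by (cases q)
    have "ip (k (\<phi> x)) (k (\<phi> y)) = (\<integral>\<xi>. w \<xi> *\<^sub>R (character (\<phi> x) \<xi> * cnj (character (\<phi> y) \<xi>)) \<partial>lborel)"
      using character_add[of "\<phi> x" "- \<phi> y"]
      by (simp add: reproducing[OF kernel_mem] kernel_eq cnj_character)
    moreover have "(\<lambda>\<xi>. w \<xi> *\<^sub>R (character (\<phi> x) \<xi> * cnj (lincomb (\<lambda>x. character (\<phi> x)) (q # L) \<xi>)))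
      = (\<lambda>\<xi>. w \<xi> *\<^sub>R (cnj b * (character (\<phi> x) \<xi> * cnj (character (\<phi> y) \<xi>))
        + character (\<phi> x) \<xi> * cnj (lincomb (\<lambda>x. character (\<phi> x)) L \<xi>)))"
      by (auto simp: q algebra_simps)
    moreover have "integrable lborel (\<lambda>\<xi>. w \<xi> *\<^sub>R (character (\<phi> x) \<xi> * cnj (character (\<phi> y) \<xi>)))"
      using int[of x "[(1, y)]"] by simp
    moreover have "ip (k (\<phi> x)) (lincomb (\<lambda>x. k (\<phi> x)) (q # L))
        = cnj b * ip (k (\<phi> x)) (k (\<phi> y)) + ip (k (\<phi> x)) (lincomb (\<lambda>x. k (\<phi> x)) L)"
      by (simp add: q ip_add_right[OF scale_mem[OF kernel_mem] lincomb_mem kernel_mem]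
          ip_scale_right[OF kernel_mem kernel_mem])
    ultimately show ?case
      using int[of x L] Cons.IH by (simp only: weighted_integral_linear)
  qed
  moreover have "(\<lambda>\<xi>. w \<xi> *\<^sub>R (lincomb (\<lambda>x. character (\<phi> x)) (p # K) \<xi> * cnj (lincomb (\<lambda>x. character (\<phi> x)) L \<xi>)))
    = (\<lambda>\<xi>. w \<xi> *\<^sub>R (a * (character (\<phi> x) \<xi> * cnj (lincomb (\<lambda>x. character (\<phi> x)) L \<xi>))
      + lincomb (\<lambda>x. character (\<phi> x)) K \<xi> * cnj (lincomb (\<lambda>x. character (\<phi> x)) L \<xi>)))"
    by (auto simp: p algebra_simps)
  moreover have "ip (lincomb (\<lambda>x. k (\<phi> x)) (p # K)) (lincomb (\<lambda>x. k (\<phi> x)) L)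
      = a * ip (k (\<phi> x)) (lincomb (\<lambda>x. k (\<phi> x)) L) + ip (lincomb (\<lambda>x. k (\<phi> x)) K) (lincomb (\<lambda>x. k (\<phi> x)) L)"
    by (simp add: p ip_add_left[OF scale_mem[OF kernel_mem] lincomb_mem lincomb_mem]
        ip_scale_left[OF kernel_mem lincomb_mem])
  ultimately show ?case
    using int[of x L] integrable_weighted_trig_product[of \<phi> K L] Cons.IH
    by (simp only: weighted_integral_linear)
qed

lemma norm_sq_lincomb:
  "(ip_norm ip (lincomb (\<lambda>x. k (\<phi> x)) L))\<^sup>2
    = (\<integral>\<xi>. w \<xi> * (cmod (lincomb (\<lambda>x. character (\<phi> x)) L \<xi>))\<^sup>2 \<partial>lborel)"
proof -
  have "complex_of_real ((ip_norm ip (lincomb (\<lambda>x. k (\<phi> x)) L))\<^sup>2)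
      = (\<integral>\<xi>. complex_of_real (w \<xi> * (cmod (lincomb (\<lambda>x. character (\<phi> x)) L \<xi>))\<^sup>2) \<partial>lborel)"
    unfolding ip_self[OF lincomb_mem, symmetric] ip_lincomb_eq_integral
    by (simp only: of_real_mult complex_norm_square scaleR_conv_of_real)
  then show ?thesis by (simp only: integral_complex_of_real of_real_eq_iff)
qed

text \<open>Here \<open>B\<close> is the adjoint of the linear part of \<open>f\<close>. The characters at \<open>f x\<close> differ from those at \<open>x\<close>
composed with \<open>B\<close> by the unimodular factor \<open>character b\<close>, which drops out of all norms.\<close>

lemma comp_dom_full_iff:
  assumes B: "linear B" and f: "\<And>x \<xi>. \<xi> \<bullet> f x = B \<xi> \<bullet> x + \<xi> \<bullet> b"
    and nonzero: "\<not> (AE \<xi> in lborel. w \<xi> = 0)"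
  defines "good \<equiv> inj B \<and> (\<exists>l>0. AE \<xi> in lborel. l * w \<xi> \<le> w (B \<xi>))"
  shows "(good \<longleftrightarrow> comp_dom H f = H) \<and> (good \<longrightarrow> bounded_operator_on H ip (comp_op f))"
proof -
  have char_f: "lincomb (\<lambda>x. character (f x)) L \<xi> = character b \<xi> * lincomb character L (B \<xi>)" for L \<xi>
  proof -
    have char: "character (f x) \<xi> = character b \<xi> * character x (B \<xi>)" for x
      unfolding character_def f cis_mult by (simp add: distrib_left add.commute)
    show ?thesis
    proof (induction L)
      case (Cons p L)
      obtain a x where p: "p = (a, x)" by (cases p)
      show ?case
        unfolding p lincomb_Cons Cons.IH char by (simp only: distrib_left mult.left_commute)
    qed simp
  qed
  have norm_f: "(ip_norm ip (lincomb (\<lambda>x. k (f x)) L))\<^sup>2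
      = (\<integral>\<xi>. w \<xi> * (cmod (lincomb character L (B \<xi>)))\<^sup>2 \<partial>lborel)" for L
    unfolding norm_sq_lincomb char_f by (simp add: norm_mult)
  have norm_k: "(ip_norm ip (lincomb k L))\<^sup>2 = (\<integral>\<xi>. w \<xi> * (cmod (lincomb character L \<xi>))\<^sup>2 \<partial>lborel)" for L
    using norm_sq_lincomb[of "\<lambda>x. x"] by simp
  have bdd: "bounded_operator_on H ip (comp_op f)" if g: good
  proof -
    obtain l where l: "inj B" "l > 0" "AE \<xi> in lborel. l * w \<xi> \<le> w (B \<xi>)"
      using g unfolding good_def by blast
    obtain C where C: "C \<ge> 0" and le: "\<And>L. (ip_norm ip (lincomb (\<lambda>x. k (f x)) L))\<^sup>2 \<le> C * (ip_norm ip (lincomb k L))\<^sup>2"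
      using quadratic_le_if_weight_le[OF B l] unfolding norm_f[symmetric] norm_k[symmetric] by blast
    show ?thesis
    proof (rule comp_op_bounded_if)
      show "sqrt C \<ge> 0" using C by simp
      show "ip_norm ip (lincomb (\<lambda>x. k (f x)) L) \<le> sqrt C * ip_norm ip (lincomb k L)" for L
        by (rule power2_le_imp_le)
          (use C le[of L] norm_nonneg[OF lincomb_kernel_mem[of L]] in \<open>auto simp: power_mult_distrib\<close>)
    qed
  qed
  moreover have "comp_dom H f = H" if good
    using bdd[OF that] by (auto simp: bounded_operator_on_def comp_dom_def)
  moreover have good if full: "comp_dom H f = H"
  proof -
    obtain M where M: "M \<ge> 0"
      "\<And>L. ip_norm ip (lincomb (\<lambda>x. k (f x)) L) \<le> M * ip_norm ip (lincomb k L)"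
      using bounded_if_comp_dom_full[OF full] by blast
    show ?thesis unfolding good_def
    proof (rule weight_le_if_quadratic_le[OF B _ _ nonzero])
      show "M\<^sup>2 \<ge> 0" by simp
      show "(\<integral>\<xi>. w \<xi> * (cmod (lincomb character L (B \<xi>)))\<^sup>2 \<partial>lborel)
          \<le> M\<^sup>2 * (\<integral>\<xi>. w \<xi> * (cmod (lincomb character L \<xi>))\<^sup>2 \<partial>lborel)" for L
        using power_mono[OF M(2) norm_nonneg[OF lincomb_mem], of L 2]
        unfolding norm_f norm_k power_mult_distrib .
    qed
  qed
  ultimately show ?thesis by blast
qed

end

section \<open>Affine composition operators\<close>

theorem proposition9:
  fixes w :: "real ^ 'n \<Rightarrow> real"
    and A :: "real ^ 'n ^ 'n"
    and b :: "real ^ 'n"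
    and f :: "real ^ 'n \<Rightarrow> real ^ 'n"
    and k :: "real ^ 'n \<Rightarrow> real ^ 'n \<Rightarrow> complex"
    and H :: "(real ^ 'n \<Rightarrow> complex) set"
    and ip :: "(real ^ 'n \<Rightarrow> complex) \<Rightarrow> (real ^ 'n \<Rightarrow> complex) \<Rightarrow> complex"
  assumes w_L1: "integrable lebesgue w"
    and w_Linf: "\<exists>C. AE \<xi> in lebesgue. \<bar>w \<xi>\<bar> \<le> C"
    and w_nonneg: "AE \<xi> in lebesgue. 0 \<le> w \<xi>"
    and w_nonzero: "\<not> (AE \<xi> in lebesgue. w \<xi> = 0)"
    and k_eq: "\<And>x y. k x y = fourier (\<lambda>\<xi>. complex_of_real (w \<xi>)) (x - y)"
    and H_rkhs: "rkhs k H ip"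
    and f_eq: "\<And>x. f x = A *v x + b"
  shows "(A \<in> weight_matrices w \<longleftrightarrow> comp_dom H f = H)
    \<and> (A \<in> weight_matrices w \<longrightarrow> bounded_operator_on H ip (comp_op f))"
proof -
  obtain w' where w': "w' \<in> borel_measurable lborel" "AE \<xi> in lborel. w \<xi> = w' \<xi>"
    using completion_ex_borel_measurable_real[OF borel_measurable_integrable[OF w_L1]] by blast
  \<comment> \<open>A Borel version of \<open>w\<close> that is nonnegative everywhere; it gives the same kernel.\<close>
  define v where "v \<xi> = max 0 (w' \<xi>)" for \<xi>
  have v_meas [measurable]: "v \<in> borel_measurable borel"
    using w'(1) unfolding v_def by simp
  have wv: "AE \<xi> in lborel. w \<xi> = v \<xi>"
    using w'(2) w_nonneg unfolding AE_completion_iff by eventually_elim (simp add: v_def)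
  have wv_leb: "AE \<xi> in lebesgue. w \<xi> = v \<xi>" using wv by (simp add: AE_completion_iff)
  have v_leb: "v \<in> borel_measurable lebesgue" by (simp add: measurable_completion)
  have "integrable lebesgue v"
    using w_L1 integrable_cong_AE[OF borel_measurable_integrable[OF w_L1] v_leb wv_leb] by simp
  then have v_int: "integrable lborel v" by (simp add: integrable_completion)
  have kv: "k x y = (\<integral>\<xi>. v \<xi> *\<^sub>R character (x - y) \<xi> \<partial>lborel)" for x y
  proof -
    have [measurable]: "character (x - y) \<in> borel_measurable lebesgue"
      by (simp add: measurable_completion)
    note [measurable] = v_leb borel_measurable_integrable[OF w_L1]
    have "k x y = (LINT \<xi>|lebesgue. w \<xi> *\<^sub>R character (x - y) \<xi>)"
      by (simp add: k_eq fourier_def character_def cis_conv_exp scaleR_conv_of_real mult_ac)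
    also have "\<dots> = (LINT \<xi>|lebesgue. v \<xi> *\<^sub>R character (x - y) \<xi>)"
      using wv_leb by (intro integral_cong_AE) auto
    also have "\<dots> = (\<integral>\<xi>. v \<xi> *\<^sub>R character (x - y) \<xi> \<partial>lborel)"
      by (intro integral_completion) measurable
    finally show ?thesis .
  qed
  interpret rkhs k H ip by (rule H_rkhs)
  interpret translation_kernel_rkhs k H ip v
    by unfold_locales (auto simp: v_int v_def kv[unfolded v_def])
  let ?B = "\<lambda>\<xi>. transpose A *v \<xi>"
  have inj_iff: "inj ?B \<longleftrightarrow> invertible A"
    using invertible_left_inverse[of "transpose A"] matrix_left_invertible_injective[of "transpose A"]
      transpose_invertible[of A] transpose_invertible[of "transpose A"]
    unfolding transpose_transpose by blast
  have B: "linear ?B" by (rule matrix_vector_mul_linear)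
  have inner_f: "\<xi> \<bullet> f x = ?B \<xi> \<bullet> x + \<xi> \<bullet> b" for x \<xi>
    by (simp add: f_eq inner_add_right dot_lmul_matrix[symmetric] vector_transpose_matrix)
  have nonzero: "\<not> (AE \<xi> in lborel. v \<xi> = 0)"
  proof
    assume "AE \<xi> in lborel. v \<xi> = 0"
    with wv have "AE \<xi> in lborel. w \<xi> = 0" by eventually_elim simp
    then show False using w_nonzero by (simp add: AE_completion_iff)
  qed
  have "A \<in> weight_matrices w \<longleftrightarrow> inj ?B \<and> (\<exists>l>0. AE \<xi> in lborel. l * v \<xi> \<le> v (?B \<xi>))"
  proof (cases "inj ?B")
    case True
    \<comment> \<open>For invertible \<open>A\<close>, composing with the transpose preserves equality almost everywhere, so \<open>w\<close> may be
      replaced by \<open>v\<close> in the definition of the weight matrices.\<close>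
    have "AE \<xi> in lborel. w (?B \<xi>) = v (?B \<xi>)"
      by (rule lborel_linear_change[OF B True]) (use wv in blast)
    then have "AE \<xi> in lborel. (l * w \<xi> \<le> w (?B \<xi>)) = (l * v \<xi> \<le> v (?B \<xi>))" for l
      using wv by eventually_elim simp
    then have "(AE \<xi> in lborel. l * w \<xi> \<le> w (?B \<xi>)) = (AE \<xi> in lborel. l * v \<xi> \<le> v (?B \<xi>))" for l
      by (rule eventually_subst)
    moreover have "invertible A" using True inj_iff by blast
    ultimately show ?thesis using True by (simp add: weight_matrices_def AE_completion_iff)
  next
    case False
    moreover have "\<not> invertible A" using False inj_iff by blast
    ultimately show ?thesis by (simp add: weight_matrices_def)
  qed
  then show ?thesis
    using comp_dom_full_iff[OF B inner_f nonzero] by simp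
qed

end
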